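(* There exists an irreducible minimal interval exchange transformation with flips (FIET) that is not uniquely ergodic and possesses three distinct invariant ergodic Borel probability measures.
   Context: An interval exchange transformation with flips (FIET) on $n$ intervals is a map $T:I\to I$ determined by a triple $(\lambda,\pi,F)$, where: - $\lambda=(\lambda_1,\dots,\lambda_n)\in\mathbb{R}_+^n$ is a vector of positive lengths, $L=\sum_i\lambda_i$, and $I$ is the interval with endpoints $0$ and $L$; - $\pi=(\pi_0,\pi_1)\in\mathcal{S}_n\times\mathcal{S}_n$ is a pair of permutations of $\{1,\dots,n\}$; - $F\subseteq\{1,\dots,n\}$ is a nonempty set (the flip set). $I$ is partitioned into $n$ consecutive subintervals, which from left to right have labels $\pi_0(1),\dots,\pi_0(n)$, the one with label $k$ (denoted $I_k$) having length $\lambda_k$. $I$ is also partitioned into $n$ consecutive subintervals which from left to right have labels $\pi_1(1),\dots,\pi_1(n)$, the one with label $k$ (denoted $J_k$) again having length $\lambda_k$. The map $T$ sends the interior of $I_k$ isometrically onto the interior of $J_k$: by an orientation-preserving translation if $k\notin F$, and by an orientation-reversing isometry if $k\in F$. At the (finitely many) discontinuity points $T$ is defined to be right-continuous (at the right endpoint $L$ one may take the left limit). $T$ is irreducible if $\{\pi_0(1),\dots,\pi_0(k)\}\neq\{\pi_1(1),\dots,\pi_1(k)\}$ for every $1\le k<n$. $T$ is minimal if the orbit of every point is dense in $I$. $T$ is uniquely ergodic if it has exactly one invariant Borel probability measure. *)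

theory Defs
  imports "HOL-Analysis.Analysis" "HOL-Probability.Probability" "HOL-Combinatorics.Permutations"
begin

text \<open>
  The data of an interval exchange transformation with flips: a length vector \<open>len\<close>, indexed by
  the labels \<open>1, \<dots>, n\<close>, the permutations \<open>\<pi>\<^sub>0\<close> and \<open>\<pi>\<^sub>1\<close> (mapping positions to labels), and the
  flip set \<open>F\<close>. Values of \<open>len\<close> outside \<open>{1..n}\<close> are irrelevant.
\<close>

definition fiet_data ::
  "nat \<Rightarrow> (nat \<Rightarrow> real) \<Rightarrow> (nat \<Rightarrow> nat) \<Rightarrow> (nat \<Rightarrow> nat) \<Rightarrow> nat set \<Rightarrow> bool" where
  "fiet_data n len \<pi>\<^sub>0 \<pi>\<^sub>1 F \<longleftrightarrow>
     (\<forall>k\<in>{1..n}. 0 < len k) \<and> \<pi>\<^sub>0 permutes {1..n} \<and> \<pi>\<^sub>1 permutes {1..n} \<and>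
     F \<subseteq> {1..n} \<and> F \<noteq> {}"

definition fiet_length :: "nat \<Rightarrow> (nat \<Rightarrow> real) \<Rightarrow> real" where
  "fiet_length n len = (\<Sum>k=1..n. len k)"

definition fiet_interval :: "nat \<Rightarrow> (nat \<Rightarrow> real) \<Rightarrow> real set" where
  "fiet_interval n len = {0..fiet_length n len}"

text \<open>
  Left endpoint of the interval with label \<open>k\<close> when the intervals are laid out in the order
  \<open>\<pi> 1, \<dots>, \<pi> n\<close>; the position of the label \<open>k\<close> is \<open>inv \<pi> k\<close>.
\<close>

definition left_end :: "(nat \<Rightarrow> real) \<Rightarrow> (nat \<Rightarrow> nat) \<Rightarrow> nat \<Rightarrow> real" where
  "left_end len \<pi> k = (\<Sum>j\<in>{1..<inv \<pi> k}. len (\<pi> j))"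

text \<open>
  Right-continuity amounts to assigning each division point to the interval on its right; the
  right endpoint of the whole interval is assigned to the last subinterval, so that the map takes
  its left limit there.
\<close>

definition fiet_label :: "nat \<Rightarrow> (nat \<Rightarrow> real) \<Rightarrow> (nat \<Rightarrow> nat) \<Rightarrow> real \<Rightarrow> nat" where
  "fiet_label n len \<pi>\<^sub>0 x =
     (THE k. k \<in> {1..n} \<and>
        (left_end len \<pi>\<^sub>0 k \<le> x \<and> x < left_end len \<pi>\<^sub>0 k + len k \<or>
         x = fiet_length n len \<and> k = \<pi>\<^sub>0 n))"

definition fiet ::
  "nat \<Rightarrow> (nat \<Rightarrow> real) \<Rightarrow> (nat \<Rightarrow> nat) \<Rightarrow> (nat \<Rightarrow> nat) \<Rightarrow> nat set \<Rightarrow> real \<Rightarrow> real" where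
  "fiet n len \<pi>\<^sub>0 \<pi>\<^sub>1 F x =
     (let k = fiet_label n len \<pi>\<^sub>0 x in
      if k \<in> F then left_end len \<pi>\<^sub>1 k + len k - (x - left_end len \<pi>\<^sub>0 k)
      else left_end len \<pi>\<^sub>1 k + (x - left_end len \<pi>\<^sub>0 k))"

definition fiet_irreducible :: "nat \<Rightarrow> (nat \<Rightarrow> nat) \<Rightarrow> (nat \<Rightarrow> nat) \<Rightarrow> bool" where
  "fiet_irreducible n \<pi>\<^sub>0 \<pi>\<^sub>1 \<longleftrightarrow> (\<forall>k. 1 \<le> k \<and> k < n \<longrightarrow> \<pi>\<^sub>0 ` {1..k} \<noteq> \<pi>\<^sub>1 ` {1..k})"

text \<open>
  The following notions concern a map \<open>T\<close> on a set \<open>X\<close> of reals. Orbits are forward orbits, since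
  \<open>fiet\<close> need not be injective at the division points.
\<close>

definition minimal_on :: "real set \<Rightarrow> (real \<Rightarrow> real) \<Rightarrow> bool" where
  "minimal_on X T \<longleftrightarrow> (\<forall>x\<in>X. X \<subseteq> closure (range (\<lambda>m. (T ^^ m) x)))"

definition invariant_prob :: "real set \<Rightarrow> (real \<Rightarrow> real) \<Rightarrow> real measure \<Rightarrow> bool" where
  "invariant_prob X T M \<longleftrightarrow>
     prob_space M \<and> sets M = sets (restrict_space borel X) \<and>
     T \<in> measurable M M \<and> distr M M T = M"

definition ergodic_prob :: "real set \<Rightarrow> (real \<Rightarrow> real) \<Rightarrow> real measure \<Rightarrow> bool" where
  "ergodic_prob X T M \<longleftrightarrow>
     invariant_prob X T M \<and>
     (\<forall>A\<in>sets M. T -` A \<inter> space M = A \<longrightarrow> measure M A = 0 \<or> measure M A = 1)"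

definition uniquely_ergodic_on :: "real set \<Rightarrow> (real \<Rightarrow> real) \<Rightarrow> bool" where
  "uniquely_ergodic_on X T \<longleftrightarrow> (\<exists>!M. invariant_prob X T M)"

end

theory Submission imports Defs begin

text \<open>
  Rotate the circle by \<open>\<alpha>\<close> and, over the arc \<open>{0..<\<beta>}\<close>, move to the next of three copies of the
  circle. If the arc length \<open>\<beta>\<close> is a suitable series in the errors \<open>\<delta>\<^sub>k\<close> of very good rational
  approximations to \<open>\<alpha>\<close> (Veech), the indicator of the arc is modulo 3 a measurable coboundary
  \<open>f (x + \<alpha>) - f x\<close>: an arc of length \<open>3 * \<delta>\<^sub>k\<close> splits into three translates by \<open>\<delta>\<^sub>k \<equiv> q\<^sub>k * \<alpha>\<close>,
  whose indicators differ by coboundaries with transfer functions of small support, so that their sum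
  is cohomologous to \<open>3\<close> times an indicator. The three translates of the graph of \<open>f\<close> then carry three
  ergodic measures. Nevertheless the skew product is minimal, since \<open>\<beta>\<close> is not in \<open>\<int> * \<alpha> + \<int>\<close>:
  the Birkhoff sums of the indicator have jumps that a cocycle trivial on an open set cannot have.
  Laying the three circles side by side with the third one reversed turns the skew product into an
  exchange of nine intervals, in which the two intervals entering or leaving the third circle are
  flipped.
\<close>

section \<open>The interval exchange\<close>

text \<open>
  The copies of the circle occupy \<open>{0..1}\<close>, \<open>{1..2}\<close> and, reversed, \<open>{2..3}\<close>. Each is cut, in its own
  orientation, into pieces of lengths \<open>\<beta>\<close>, \<open>1 - \<alpha> - \<beta>\<close> and \<open>\<alpha>\<close>; the labels number the nine pieces from
  left to right.
\<close>

definition exchange_lengths :: "real \<Rightarrow> real \<Rightarrow> nat \<Rightarrow> real" where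
  "exchange_lengths \<alpha> \<beta> k =
     (if k \<in> {1, 4, 9} then \<beta> else if k \<in> {3, 6, 7} then \<alpha> else 1 - \<alpha> - \<beta>)"

text \<open>In the orientation of each circle the arriving pieces are the wrapped piece of length
  \<open>\<alpha>\<close>, then the piece of length \<open>\<beta>\<close> sent by the preceding
  circle, then the piece of length \<open>1 - \<alpha> - \<beta>\<close>. Positions 7 to 9, on the
  third circle, list them in reverse.\<close>

definition exchange_perm :: "nat \<Rightarrow> nat" where
  "exchange_perm = id(1 := 3, 2 := 9, 3 := 2, 4 := 6, 5 := 1, 6 := 5, 7 := 8, 8 := 4, 9 := 7)"

text \<open>The branches are the nine pieces in order, closed on the left as right-continuity
  requires; the last one also takes in the endpoint 3.\<close>

definition flip_map :: "real \<Rightarrow> real \<Rightarrow> real \<Rightarrow> real" where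
  "flip_map \<alpha> \<beta> y =
     (if y < \<beta> then 1 + \<alpha> + y else if y < 1 - \<alpha> then y + \<alpha> else if y < 1 then y - (1 - \<alpha>)
      else if y < 1 + \<beta> then 4 - \<alpha> - y else if y < 2 - \<alpha> then y + \<alpha> else if y < 2 then y - (1 - \<alpha>)
      else if y < 2 + \<alpha> then y + 1 - \<alpha> else if y < 3 - \<beta> then y - \<alpha> else \<alpha> + 3 - y)"

section \<open>Combinatorial data of the exchange and its closed form\<close>

lemma labels_eq: "{1..9::nat} = {1,2,3,4,5,6,7,8,9}"
  by (simp add: atLeastAtMost_upt upt_conv_Cons numeral_eq_Suc)

lemma exchange_perm_permutes: "exchange_perm permutes {1..9}"
proof (rule bij_imp_permutes)
  have img: "exchange_perm ` {1..9} = {1..9}"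
    unfolding labels_eq by (auto simp: exchange_perm_def)
  then have "inj_on exchange_perm {1..9}"
    by (intro eq_card_imp_inj_on) auto
  with img show "bij_betw exchange_perm {1..9} {1..9}"
    by (simp add: bij_betw_def)
  show "exchange_perm x = x" if "x \<notin> {1..9}" for x
    using that unfolding labels_eq by (auto simp: exchange_perm_def)
qed

lemma inv_exchange_perm:
  "inv exchange_perm 1 = 5" "inv exchange_perm 2 = 3" "inv exchange_perm 3 = 1"
  "inv exchange_perm 4 = 8" "inv exchange_perm 5 = 6" "inv exchange_perm 6 = 4"
  "inv exchange_perm 7 = 9" "inv exchange_perm 8 = 7" "inv exchange_perm 9 = 2"
  by (simp_all only: permutes_inv_eq[OF exchange_perm_permutes], simp_all add: exchange_perm_def)

lemma initial_segments:
  "{1..<1::nat} = {}" "{1..<2::nat} = {1}" "{1..<3::nat} = {1,2}" "{1..<4::nat} = {1,2,3}"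
  "{1..<5::nat} = {1,2,3,4}" "{1..<6::nat} = {1,2,3,4,5}" "{1..<7::nat} = {1,2,3,4,5,6}"
  "{1..<8::nat} = {1,2,3,4,5,6,7}" "{1..<9::nat} = {1,2,3,4,5,6,7,8}"
  by (simp_all add: atLeastLessThan_upt upt_conv_Cons numeral_eq_Suc)

lemma fiet_length_exchange: "fiet_length 9 (exchange_lengths \<alpha> \<beta>) = 3"
  unfolding fiet_length_def labels_eq by (simp add: exchange_lengths_def)

text \<open>The label 9 is last in the domain but second in the image, so equal initial segments are
  possible only for \<open>k = 1\<close>, where the labels are 1 and 3.\<close>

lemma fiet_irreducible_exchange: "fiet_irreducible 9 id exchange_perm"
  unfolding fiet_irreducible_def
proof (intro allI impI notI)
  fix k :: nat assume k: "1 \<le> k \<and> k < 9" and eq: "id ` {1..k} = exchange_perm ` {1..k}"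
  have "k = 1"
  proof (rule ccontr)
    assume "k \<noteq> 1"
    then have "exchange_perm 2 \<in> id ` {1..k}"
      unfolding eq using k by (intro imageI) auto
    moreover have "exchange_perm 2 = 9"
      by (simp add: exchange_perm_def)
    ultimately show False
      using k by simp
  qed
  then have "exchange_perm 1 = 1"
    using eq by simp
  then show False
    by (simp add: exchange_perm_def)
qed


context
  fixes \<alpha> \<beta> :: real
  assumes pos: "0 < \<alpha>" "0 < \<beta>" and small: "\<alpha> + \<beta> < 1"
begin

lemma fiet_data_exchange: "fiet_data 9 (exchange_lengths \<alpha> \<beta>) id exchange_perm {4, 9}"
  unfolding fiet_data_def
  using pos small exchange_perm_permutes permutes_id
  by (auto simp: exchange_lengths_def)

lemma left_end_id:
  "left_end (exchange_lengths \<alpha> \<beta>) id 1 = 0"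
  "left_end (exchange_lengths \<alpha> \<beta>) id 2 = \<beta>"
  "left_end (exchange_lengths \<alpha> \<beta>) id 3 = 1 - \<alpha>"
  "left_end (exchange_lengths \<alpha> \<beta>) id 4 = 1"
  "left_end (exchange_lengths \<alpha> \<beta>) id 5 = 1 + \<beta>"
  "left_end (exchange_lengths \<alpha> \<beta>) id 6 = 2 - \<alpha>"
  "left_end (exchange_lengths \<alpha> \<beta>) id 7 = 2"
  "left_end (exchange_lengths \<alpha> \<beta>) id 8 = 2 + \<alpha>"
  "left_end (exchange_lengths \<alpha> \<beta>) id 9 = 3 - \<beta>"
  unfolding left_end_def inv_id id_apply initial_segments
  by (simp_all add: exchange_lengths_def)

lemma left_end_exchange_perm:
  "left_end (exchange_lengths \<alpha> \<beta>) exchange_perm 1 = 1 + \<alpha>"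
  "left_end (exchange_lengths \<alpha> \<beta>) exchange_perm 2 = \<alpha> + \<beta>"
  "left_end (exchange_lengths \<alpha> \<beta>) exchange_perm 3 = 0"
  "left_end (exchange_lengths \<alpha> \<beta>) exchange_perm 4 = 3 - \<alpha> - \<beta>"
  "left_end (exchange_lengths \<alpha> \<beta>) exchange_perm 5 = 1 + \<alpha> + \<beta>"
  "left_end (exchange_lengths \<alpha> \<beta>) exchange_perm 6 = 1"
  "left_end (exchange_lengths \<alpha> \<beta>) exchange_perm 7 = 3 - \<alpha>"
  "left_end (exchange_lengths \<alpha> \<beta>) exchange_perm 8 = 2"
  "left_end (exchange_lengths \<alpha> \<beta>) exchange_perm 9 = \<alpha>"
  unfolding left_end_def inv_exchange_perm initial_segments
  by (simp_all add: exchange_lengths_def exchange_perm_def)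

lemma flip_map_cases:
  assumes "y \<in> {0..3}"
  obtains "0 \<le> y" "y < \<beta>" | "\<beta> \<le> y" "y < 1 - \<alpha>" | "1 - \<alpha> \<le> y" "y < 1"
    | "1 \<le> y" "y < 1 + \<beta>" | "1 + \<beta> \<le> y" "y < 2 - \<alpha>" | "2 - \<alpha> \<le> y" "y < 2"
    | "2 \<le> y" "y < 2 + \<alpha>" | "2 + \<alpha> \<le> y" "y < 3 - \<beta>" | "3 - \<beta> \<le> y" "y \<le> 3"
  using assms by (meson atLeastAtMost_iff not_le)

lemma fiet_label_exchange:
  assumes k: "k \<in> {1..9}"
    and y: "left_end (exchange_lengths \<alpha> \<beta>) id k \<le> y"
      "y < left_end (exchange_lengths \<alpha> \<beta>) id k + exchange_lengths \<alpha> \<beta> k \<or> k = 9 \<and> y = 3"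
  shows "fiet_label 9 (exchange_lengths \<alpha> \<beta>) id y = k"
  unfolding fiet_label_def
proof (rule the_equality)
  show "k \<in> {1..9} \<and>
    (left_end (exchange_lengths \<alpha> \<beta>) id k \<le> y \<and>
     y < left_end (exchange_lengths \<alpha> \<beta>) id k + exchange_lengths \<alpha> \<beta> k \<or>
     y = fiet_length 9 (exchange_lengths \<alpha> \<beta>) \<and> k = id 9)"
    using assms by (auto simp: fiet_length_exchange)
  fix l
  assume l: "l \<in> {1..9} \<and>
    (left_end (exchange_lengths \<alpha> \<beta>) id l \<le> y \<and>
     y < left_end (exchange_lengths \<alpha> \<beta>) id l + exchange_lengths \<alpha> \<beta> l \<or>
     y = fiet_length 9 (exchange_lengths \<alpha> \<beta>) \<and> l = id 9)"
  have "k = 1 \<or> k = 2 \<or> k = 3 \<or> k = 4 \<or> k = 5 \<or> k = 6 \<or> k = 7 \<or> k = 8 \<or> k = 9"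
    using k unfolding labels_eq by blast
  moreover have "l = 1 \<or> l = 2 \<or> l = 3 \<or> l = 4 \<or> l = 5 \<or> l = 6 \<or> l = 7 \<or> l = 8 \<or> l = 9"
    using l unfolding labels_eq by blast
  ultimately show "l = k"
    using y l pos small
    by (elim disjE; simp add: fiet_length_exchange left_end_id exchange_lengths_def del: One_nat_def)
qed

lemma fiet_exchange:
  assumes "y \<in> {0..3}"
  shows "fiet 9 (exchange_lengths \<alpha> \<beta>) id exchange_perm {4, 9} y = flip_map \<alpha> \<beta> y"
proof -
  note defs = left_end_id left_end_exchange_perm flip_map_def exchange_lengths_def
  show ?thesis
    using assms
  proof (cases rule: flip_map_cases)
    case 1
    then have "fiet_label 9 (exchange_lengths \<alpha> \<beta>) id y = 1"
      using pos small by (intro fiet_label_exchange) (auto simp: defs simp del: One_nat_def)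
    then show ?thesis
      using 1 pos small by (simp add: fiet_def defs del: One_nat_def)
  next
    case 2
    then have "fiet_label 9 (exchange_lengths \<alpha> \<beta>) id y = 2"
      using pos small by (intro fiet_label_exchange) (auto simp: defs simp del: One_nat_def)
    then show ?thesis
      using 2 pos small by (simp add: fiet_def defs del: One_nat_def)
  next
    case 3
    then have "fiet_label 9 (exchange_lengths \<alpha> \<beta>) id y = 3"
      using pos small by (intro fiet_label_exchange) (auto simp: defs simp del: One_nat_def)
    then show ?thesis
      using 3 pos small by (simp add: fiet_def defs del: One_nat_def)
  next
    case 4
    then have "fiet_label 9 (exchange_lengths \<alpha> \<beta>) id y = 4"
      using pos small by (intro fiet_label_exchange) (auto simp: defs simp del: One_nat_def)
    then show ?thesis
      using 4 pos small by (simp add: fiet_def defs del: One_nat_def)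
  next
    case 5
    then have "fiet_label 9 (exchange_lengths \<alpha> \<beta>) id y = 5"
      using pos small by (intro fiet_label_exchange) (auto simp: defs simp del: One_nat_def)
    then show ?thesis
      using 5 pos small by (simp add: fiet_def defs del: One_nat_def)
  next
    case 6
    then have "fiet_label 9 (exchange_lengths \<alpha> \<beta>) id y = 6"
      using pos small by (intro fiet_label_exchange) (auto simp: defs simp del: One_nat_def)
    then show ?thesis
      using 6 pos small by (simp add: fiet_def defs del: One_nat_def)
  next
    case 7
    then have "fiet_label 9 (exchange_lengths \<alpha> \<beta>) id y = 7"
      using pos small by (intro fiet_label_exchange) (auto simp: defs simp del: One_nat_def)
    then show ?thesis
      using 7 pos small by (simp add: fiet_def defs del: One_nat_def)
  next
    case 8
    then have "fiet_label 9 (exchange_lengths \<alpha> \<beta>) id y = 8"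
      using pos small by (intro fiet_label_exchange) (auto simp: defs simp del: One_nat_def)
    then show ?thesis
      using 8 pos small by (simp add: fiet_def defs del: One_nat_def)
  next
    case 9
    then have "fiet_label 9 (exchange_lengths \<alpha> \<beta>) id y = 9"
      using pos small by (intro fiet_label_exchange) (auto simp: defs simp del: One_nat_def)
    then show ?thesis
      using 9 pos small by (simp add: fiet_def defs del: One_nat_def)
  qed
qed

lemma flip_map_in: "y \<in> {0..3} \<Longrightarrow> flip_map \<alpha> \<beta> y \<in> {0..3}"
  using pos small by (auto simp: flip_map_def)

end

section \<open>Circle coordinates on the three copies\<close>

definition fibre_pos :: "real \<Rightarrow> int \<Rightarrow> real" where
  "fibre_pos x i = (if i mod 3 = 0 then frac x else if i mod 3 = 1 then 1 + frac x else 3 - frac x)"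

text \<open>A circle coordinate modulo 1: on the reversed third copy the point \<open>3 - u\<close>
  has coordinate \<open>u\<close>, which is congruent to its negative.\<close>

definition base_point :: "real \<Rightarrow> real" where
  "base_point y = (if y < 2 then y else - y)"

text \<open>Each of the nine branches can be checked directly. The cut points are included, so that
  the orbit of any point projects to an orbit of the rotation.\<close>

lemma flip_map_base_point:
  assumes "y \<in> {0..3}" "0 < \<alpha>" "0 < \<beta>" "\<alpha> + \<beta> < 1"
  shows "base_point (flip_map \<alpha> \<beta> y) - base_point y - \<alpha> \<in> \<int>"
proof -
  have "base_point (flip_map \<alpha> \<beta> y) - base_point y - \<alpha> \<in> {-4,-3,-2,-1,0,1,2,3,4}"
    using assms by (auto simp: base_point_def flip_map_def)
  then show ?thesis by auto
qed

text \<open>This identifies the exchange with the skew product. Cut points are excluded because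
  right-continuity on the reversed copy is left-continuity in the circle coordinate.\<close>

lemma flip_map_fibre_pos:
  assumes "0 < \<alpha>" "0 < \<beta>" "\<alpha> + \<beta> < 1"
    and "x \<notin> \<int>" "x - \<beta> \<notin> \<int>" "x + \<alpha> \<notin> \<int>"
  shows "flip_map \<alpha> \<beta> (fibre_pos x i) = fibre_pos (x + \<alpha>) (i + of_bool (frac x < \<beta>))"
proof -
  define u where "u = frac x"
  have u: "0 < u" "u < 1"
    using assms(4) by (auto simp: u_def frac_lt_1)
  have x: "x = of_int \<lfloor>x\<rfloor> + u"
    by (simp add: u_def frac_def)
  have "u \<noteq> \<beta>" "u + \<alpha> \<noteq> 1"
    using assms(5,6) x by (metis Ints_of_int add_diff_cancel_right', metis Ints_of_int Ints_1 Ints_add add.assoc)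
  moreover have "frac \<alpha> = \<alpha>"
    using assms by (simp add: frac_eq)
  then have "frac (x + \<alpha>) = (if u + \<alpha> < 1 then u + \<alpha> else u + \<alpha> - 1)"
    by (simp add: frac_add u_def)
  moreover have "i mod 3 = 0 \<and> (i + 1) mod 3 = 1 \<or> i mod 3 = 1 \<and> (i + 1) mod 3 = 2 \<or> i mod 3 = 2 \<and> (i + 1) mod 3 = 0"
    by presburger
  ultimately show ?thesis
    using u assms(1-3) unfolding fibre_pos_def u_def[symmetric]
    by (elim disjE) (simp_all add: flip_map_def)
qed

section \<open>Minimality\<close>

text \<open>The assumption \<open>independent\<close> puts the two discontinuities 0 and
  \<open>\<beta>\<close> of the indicator of the arc on different orbits of the rotation.\<close>

locale rotation_pair =
  fixes \<alpha> \<beta> :: real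
  assumes pos: "0 < \<alpha>" "0 < \<beta>" and small: "\<alpha> + \<beta> < 1"
    and irrational: "\<alpha> \<notin> \<rat>"
    and independent: "\<And>m r :: int. \<beta> \<noteq> of_int m * \<alpha> + of_int r"
begin

section \<open>Orbits of the rotation by \<open>\<alpha>\<close>\<close>

lemma orbit_hits_Ints_once:
  assumes "x + real m * \<alpha> \<in> \<int>" "x + real n * \<alpha> \<in> \<int>"
  shows "m = n"
proof (rule ccontr)
  assume "m \<noteq> n"
  then have nz: "real m - real n \<noteq> 0" by simp
  have "(x + real m * \<alpha>) - (x + real n * \<alpha>) \<in> \<int>"
    using assms by (rule Ints_diff)
  then have "(real m - real n) * \<alpha> \<in> \<rat>"
    using Ints_subset_Rats by (auto simp: algebra_simps)
  moreover have "real m - real n \<in> \<rat>" by simp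
  ultimately have "(real m - real n) * \<alpha> / (real m - real n) \<in> \<rat>"
    by (rule Rats_divide)
  then show False using nz irrational by simp
qed

lemma Ints_add_of_int: "x + of_int m \<in> \<int> \<longleftrightarrow> x \<in> \<int>" for x :: real
  by (metis Ints_add Ints_diff Ints_of_int add_diff_cancel_right')

lemma orbit_eventually_not_Ints: "\<forall>\<^sub>F n in sequentially. x + real n * \<alpha> \<notin> \<int>"
proof (cases "\<exists>m. x + real m * \<alpha> \<in> \<int>")
  case True
  then obtain m where "x + real m * \<alpha> \<in> \<int>" by blast
  then have "x + real n * \<alpha> \<notin> \<int>" if "n > m" for n
    using orbit_hits_Ints_once[of x m n] that by auto
  then show ?thesis
    by (auto simp: eventually_at_top_dense)
qed simp

lemma orbit_dense:
  assumes "open U" "U \<noteq> {}"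
  shows "\<exists>n p. n > 0 \<and> x + real n * \<alpha> - of_int p \<in> U" "\<exists>n p. n > 0 \<and> x - real n * \<alpha> - of_int p \<in> U"
proof -
  obtain u where "u \<in> U" using assms by auto
  then obtain e where e: "e > 0" "\<And>y. \<bar>y - u\<bar> < e \<Longrightarrow> y \<in> U"
    using assms(1) by (metis open_dist dist_real_def)
  have *: "\<exists>n p. n > 0 \<and> x + real n * \<gamma> - of_int p \<in> U" if irr: "\<gamma> \<notin> \<rat>" for \<gamma>
  proof -
    obtain h k where "k > 0" "\<bar>of_int k * \<gamma> - of_int h - (u - x)\<bar> < e"
      using sequence_of_fractional_parts_is_dense[OF irr e(1)] by blast
    then have "nat k > 0 \<and> x + real (nat k) * \<gamma> - of_int h \<in> U"
      by (auto intro!: e(2) simp: algebra_simps)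
    then show ?thesis by blast
  qed
  show "\<exists>n p. n > 0 \<and> x + real n * \<alpha> - of_int p \<in> U"
    using irrational by (rule *)
  have "- \<alpha> \<notin> \<rat>" using irrational Rats_minus_iff by blast
  from *[OF this] show "\<exists>n p. n > 0 \<and> x - real n * \<alpha> - of_int p \<in> U"
    by simp
qed

section \<open>Birkhoff sums of the indicator of the arc\<close>

definition hits :: "nat \<Rightarrow> real \<Rightarrow> int" where
  "hits n x = (\<Sum>j<n. of_bool (frac (x + real j * \<alpha>) < \<beta>))"

lemma hits_add: "hits (m + n) x = hits m x + hits n (x + real m * \<alpha>)"
  unfolding hits_def by (induction n) (simp_all add: algebra_simps)

lemma hits_diff_int [simp]: "hits n (x - of_int p) = hits n x"
proof -
  have "frac (x - of_int p + real j * \<alpha>) = frac (x + real j * \<alpha>)" for j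
    using frac_add_of_int_right[of "x + real j * \<alpha>" "-p"] by (simp add: algebra_simps)
  then show ?thesis by (simp add: hits_def)
qed

lemma frac_less_locally_constant:
  assumes "x \<notin> \<int>" "x - \<beta> \<notin> \<int>"
  shows "\<forall>\<^sub>F y in nhds x. (frac y < \<beta>) = (frac x < \<beta>)"
proof -
  have f: "0 < frac x" "frac x < 1" "x = of_int \<lfloor>x\<rfloor> + frac x"
    using assms frac_gt_0_iff[of x] frac_lt_1[of x] by (blast, blast, simp add: frac_def)
  have "frac x \<noteq> \<beta>"
    using assms(2) f(3) by (metis Ints_of_int add_diff_cancel_right')
  define W where "W = (if frac x < \<beta> then {of_int \<lfloor>x\<rfloor> <..< of_int \<lfloor>x\<rfloor> + \<beta>}
    else {of_int \<lfloor>x\<rfloor> + \<beta> <..< of_int \<lfloor>x\<rfloor> + 1})"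
  have "x \<in> W"
    using f(1,2) \<open>frac x \<noteq> \<beta>\<close> unfolding W_def frac_def
    by (auto simp del: frac_gt_0_iff)
  moreover have "open W" by (simp add: W_def)
  ultimately have "\<forall>\<^sub>F y in nhds x. y \<in> W"
    using eventually_nhds_in_open by blast
  then show ?thesis
  proof (rule eventually_mono)
    fix y assume y: "y \<in> W"
    then have "\<lfloor>y\<rfloor> = \<lfloor>x\<rfloor>"
      using pos small by (intro floor_unique) (auto simp: W_def split: if_splits)
    with y show "(frac y < \<beta>) = (frac x < \<beta>)"
      by (auto simp: W_def frac_def split: if_splits)
  qed
qed

lemma hits_term_locally_constant:
  assumes "x + t \<notin> \<int>" "x + t - \<beta> \<notin> \<int>"
  shows "\<forall>\<^sub>F y in nhds x. (frac (y + t) < \<beta>) = (frac (x + t) < \<beta>)"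
proof -
  have "filterlim (\<lambda>y. y + t) (nhds (x + t)) (nhds x)"
    by (intro tendsto_intros filterlim_ident)
  with frac_less_locally_constant[OF assms] show ?thesis
    by (rule eventually_compose_filterlim)
qed

lemma hits_locally_constant:
  assumes "\<And>j. j < k \<Longrightarrow> x + real j * \<alpha> \<notin> \<int> \<and> x + real j * \<alpha> - \<beta> \<notin> \<int>"
  shows "\<forall>\<^sub>F y in nhds x. hits k y = hits k x"
proof -
  have "\<forall>\<^sub>F y in nhds x. \<forall>j\<in>{..<k}. (frac (y + real j * \<alpha>) < \<beta>) = (frac (x + real j * \<alpha>) < \<beta>)"
    using assms by (intro eventually_ball_finite) (auto intro!: hits_term_locally_constant)
  then show ?thesis
    by (rule eventually_mono) (simp add: hits_def)
qed

text \<open>The forward orbit avoids both discontinuities; then the skew product formula holds at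
  every time and each Birkhoff sum is constant near the point.\<close>

definition regular :: "real \<Rightarrow> bool" where
  "regular x \<longleftrightarrow> (\<forall>j. x + real j * \<alpha> \<notin> \<int> \<and> x + real j * \<alpha> - \<beta> \<notin> \<int>)"

lemma regular_shift:
  assumes "regular x"
  shows "regular (x + real n * \<alpha> - of_int p)"
  unfolding regular_def
proof (intro allI)
  fix j
  have "x + real n * \<alpha> - of_int p + real j * \<alpha> = x + real (n + j) * \<alpha> + of_int (- p)"
    "x + real n * \<alpha> - of_int p + real j * \<alpha> - \<beta> = x + real (n + j) * \<alpha> - \<beta> + of_int (- p)"
    by (simp_all add: algebra_simps)
  then show "x + real n * \<alpha> - of_int p + real j * \<alpha> \<notin> \<int> \<and>
      x + real n * \<alpha> - of_int p + real j * \<alpha> - \<beta> \<notin> \<int>"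
    using assms unfolding regular_def by (simp only: Ints_add_of_int) blast
qed

lemma flip_map_orbit:
  assumes "regular x"
  shows "(flip_map \<alpha> \<beta> ^^ n) (fibre_pos x i) = fibre_pos (x + real n * \<alpha>) (i + hits n x)"
proof (induction n)
  case (Suc n)
  have "x + real n * \<alpha> + \<alpha> = x + real (Suc n) * \<alpha>" by (simp add: algebra_simps)
  with assms have "x + real n * \<alpha> \<notin> \<int>" "x + real n * \<alpha> - \<beta> \<notin> \<int>" "x + real n * \<alpha> + \<alpha> \<notin> \<int>"
    unfolding regular_def by metis+
  from flip_map_fibre_pos[OF pos small this]
  show ?case
    by (simp add: Suc hits_def algebra_simps)
qed (simp add: hits_def)

section \<open>Fibre displacements with which an orbit enters an open set\<close>

definition visits :: "real \<Rightarrow> real set \<Rightarrow> int set" where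
  "visits x U = {hits n x mod 3 | n p. x + real n * \<alpha> - of_int p \<in> U}"

lemma visits_subset: "visits x U \<subseteq> {0, 1, 2}"
  by (auto simp: visits_def)

lemma finite_visits: "finite (visits x U)"
  using visits_subset by (rule finite_subset) simp

lemma visits_nonempty: "open U \<Longrightarrow> U \<noteq> {} \<Longrightarrow> visits x U \<noteq> {}"
  using orbit_dense(1)[of U x] by (auto simp: visits_def)

lemma visits_mono: "U \<subseteq> W \<Longrightarrow> visits x U \<subseteq> visits x W"
  unfolding visits_def by blast

text \<open>Since 3 is prime, a nonzero residue generates the whole group, so a nonempty set closed
  under that shift is everything.\<close>

lemma proper_shift_invariant:
  fixes V :: "int set"
  assumes "V \<subseteq> {0, 1, 2}" "V \<noteq> {}" "V \<noteq> {0, 1, 2}" "\<And>v. v \<in> V \<Longrightarrow> (v + s) mod 3 \<in> V"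
  shows "s mod 3 = 0"
proof (rule ccontr)
  assume "s mod 3 \<noteq> 0"
  then have s: "s mod 3 = 1 \<or> s mod 3 = 2" by presburger
  have *: "(v + s mod 3) mod 3 \<in> V" if "v \<in> V" for v
    using assms(4)[OF that] by (simp add: mod_simps)
  obtain v where "v \<in> V" "v \<in> {0,1,2}" using assms by auto
  moreover have "(v + s mod 3) mod 3 \<in> V" "((v + s mod 3) mod 3 + s mod 3) mod 3 \<in> V"
    using * \<open>v \<in> V\<close> by auto
  ultimately have "{0,1,2} \<subseteq> V"
    using s by auto
  with assms show False by auto
qed

text \<open>If a residue is missed, shrink \<open>U\<close> to a set \<open>W\<close> with the
  fewest visited residues, so that every smaller open set is visited with the same residues. Each
  return to \<open>W\<close> then shifts this proper set into itself and has displacement 0 modulo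
  3. Two nearby returns whose displacements differ by one give the contradiction.\<close>

lemma visits_full:
  assumes x: "regular x" and U: "open U" "U \<noteq> {}"
  shows "visits x U = {0, 1, 2}"
proof (rule ccontr)
  assume proper: "visits x U \<noteq> {0, 1, 2}"
  define Q where "Q W \<longleftrightarrow> open W \<and> W \<noteq> {} \<and> W \<subseteq> U" for W
  obtain W where W: "Q W" and least: "\<And>W'. Q W' \<Longrightarrow> card (visits x W) \<le> card (visits x W')"
    using ex_has_least_nat[of Q U "\<lambda>W. card (visits x W)"] U unfolding Q_def by blast
  have W_open: "open W" "W \<noteq> {}" "W \<subseteq> U" using W by (auto simp: Q_def)
  have same: "visits x W' = visits x W" if "open W'" "W' \<noteq> {}" "W' \<subseteq> W" for W'
  proof (rule card_seteq)
    show "card (visits x W) \<le> card (visits x W')"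
      using that W_open by (intro least) (auto simp: Q_def)
  qed (use that finite_visits visits_mono in auto)
  have W_proper: "visits x W \<noteq> {0, 1, 2}"
    using proper visits_mono[OF W_open(3), of x] visits_subset[of x U] by auto
  \<comment> \<open>Near \<open>y\<close> the displacement over \<open>k\<close> steps is constant.
    By minimality every residue \<open>v\<close> is realised by a visit to that neighbourhood, and
    \<open>k\<close> further steps lead back into \<open>W\<close> with residue
    \<open>v + hits k y\<close>.\<close>
  have return: "hits k y mod 3 = 0"
    if y: "y = x + real n * \<alpha> - of_int p" "y \<in> W" and yk: "y + real k * \<alpha> - of_int r \<in> W" for n p y k r
  proof (rule proper_shift_invariant[OF visits_subset visits_nonempty[OF W_open(1,2)] W_proper])
    fix v assume v: "v \<in> visits x W"
    have "regular y" unfolding y(1) using x by (rule regular_shift)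
    then have "\<forall>\<^sub>F z in nhds y. hits k z = hits k y"
      by (intro hits_locally_constant) (auto simp: regular_def)
    moreover have "\<forall>\<^sub>F z in nhds y. z \<in> W"
      using y W_open eventually_nhds_in_open by blast
    moreover have "\<forall>\<^sub>F z in nhds y. z + real k * \<alpha> - of_int r \<in> W"
      by (rule topological_tendstoD[OF _ W_open(1) yk]) (intro tendsto_intros filterlim_ident)
    ultimately have "\<forall>\<^sub>F z in nhds y. hits k z = hits k y \<and> z \<in> W \<and> z + real k * \<alpha> - of_int r \<in> W"
      by eventually_elim auto
    then obtain W' where W': "open W'" "y \<in> W'"
      "\<And>z. z \<in> W' \<Longrightarrow> hits k z = hits k y \<and> z \<in> W \<and> z + real k * \<alpha> - of_int r \<in> W"
      unfolding eventually_nhds by auto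
    then have "v \<in> visits x W'"
      using v same[of W'] by auto
    then obtain m q where m: "v = hits m x mod 3" "x + real m * \<alpha> - of_int q \<in> W'"
      by (auto simp: visits_def)
    have "hits k (x + real m * \<alpha>) = hits k y"
      using W'(3)[OF m(2)] by simp
    then have "(v + hits k y) mod 3 = hits (m + k) x mod 3"
      by (simp add: m hits_add mod_simps)
    moreover have "x + real (m + k) * \<alpha> - of_int (q + r) \<in> W"
      using W'(3)[OF m(2)] by (simp add: algebra_simps)
    ultimately show "(v + hits k y) mod 3 \<in> visits x W"
      unfolding visits_def by blast
  qed
  \<comment> \<open>\<open>hits k\<close> jumps by one at \<open>z\<close>, a preimage of the discontinuity \<open>0\<close> of the cocycle; the
    jumps at preimages of \<open>\<beta>\<close> cannot compensate this, by independence.\<close>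
  obtain j q where jq: "0 - real j * \<alpha> - of_int q \<in> W"
    using orbit_dense(2)[OF W_open(1,2)] by blast
  define z where "z = - real j * \<alpha> - of_int q"
  have zW: "z \<in> W" using jq by (simp add: z_def)
  obtain l r where l: "l > 0" "0 + real l * \<alpha> - of_int r \<in> W"
    using orbit_dense(1)[OF W_open(1,2)] by blast
  \<comment> \<open>Starting at \<open>z\<close>, the orbit passes through 0 modulo 1 at time
    \<open>j\<close> and is back in \<open>W\<close> at time \<open>k\<close>; \<open>l > 0\<close>
    ensures that the term with index \<open>j\<close> belongs to \<open>hits k\<close>.\<close>
  define k where "k = j + l"
  have zk: "z + real k * \<alpha> - of_int (r - q) \<in> W"
    using l by (simp add: z_def k_def algebra_simps)
  have zi: "z + real i * \<alpha> \<notin> \<int>" if "i \<noteq> j" for i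
  proof
    assume "z + real i * \<alpha> \<in> \<int>"
    moreover have "z + real j * \<alpha> \<in> \<int>" by (simp add: z_def)
    ultimately show False using orbit_hits_Ints_once that by blast
  qed
  have z\<beta>: "z + real i * \<alpha> - \<beta> \<notin> \<int>" for i
  proof
    assume "z + real i * \<alpha> - \<beta> \<in> \<int>"
    then obtain m where "z + real i * \<alpha> - \<beta> = of_int m" by (auto elim: Ints_cases)
    then have "\<beta> = of_int (int i - int j) * \<alpha> + of_int (- q - m)"
      by (simp add: z_def algebra_simps)
    then show False using independent by blast
  qed
  have "\<forall>\<^sub>F y in nhds z. \<forall>i\<in>{..<k} - {j}. (frac (y + real i * \<alpha>) < \<beta>) = (frac (z + real i * \<alpha>) < \<beta>)"
    using zi z\<beta> by (intro eventually_ball_finite) (auto intro!: hits_term_locally_constant)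
  moreover have "\<forall>\<^sub>F y in nhds z. y \<in> W"
    using zW W_open eventually_nhds_in_open by blast
  moreover have "\<forall>\<^sub>F y in nhds z. y + real k * \<alpha> - of_int (r - q) \<in> W"
    by (rule topological_tendstoD[OF _ W_open(1) zk]) (intro tendsto_intros filterlim_ident)
  ultimately have "\<forall>\<^sub>F y in nhds z.
      (\<forall>i\<in>{..<k} - {j}. (frac (y + real i * \<alpha>) < \<beta>) = (frac (z + real i * \<alpha>) < \<beta>)) \<and>
      y \<in> W \<and> y + real k * \<alpha> - of_int (r - q) \<in> W"
    by eventually_elim auto
  then obtain e where e: "e > 0" and near: "\<And>y. \<bar>y - z\<bar> < e \<Longrightarrow>
      (\<forall>i\<in>{..<k} - {j}. (frac (y + real i * \<alpha>) < \<beta>) = (frac (z + real i * \<alpha>) < \<beta>)) \<and>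
      y \<in> W \<and> y + real k * \<alpha> - of_int (r - q) \<in> W"
    unfolding eventually_nhds_metric dist_real_def by blast
  \<comment> \<open>Within \<open>d\<close> to the right of \<open>z\<close> the fractional part at
    time \<open>j\<close> is below \<open>\<beta>\<close>; within \<open>d\<close> to the left it is
    above \<open>1 - d\<close>, hence at least \<open>\<beta>\<close>.\<close>
  define d where "d = min e (min \<beta> (1 - \<beta>))"
  have d: "0 < d" "d \<le> e" "d \<le> \<beta>" "d \<le> 1 - \<beta>"
    using e pos small by (auto simp: d_def)
  have hits_near: "hits k y = (\<Sum>i\<in>{..<k} - {j}. of_bool (frac (z + real i * \<alpha>) < \<beta>)) +
      of_bool (frac (y + real j * \<alpha>) < \<beta>)" if "\<bar>y - z\<bar> < e" for y
  proof -
    have "hits k y = of_bool (frac (y + real j * \<alpha>) < \<beta>) +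
        (\<Sum>i\<in>{..<k} - {j}. of_bool (frac (y + real i * \<alpha>) < \<beta>))"
      unfolding hits_def by (rule sum.remove) (use l in \<open>auto simp: k_def\<close>)
    then show ?thesis using near[OF that] by simp
  qed
  have frac_near: "frac (y + real j * \<alpha>) = frac (y - z)" for y
    using frac_add_of_int_right[of "y - z" "-q"] by (simp add: z_def algebra_simps)
  obtain n p where np: "x + real n * \<alpha> - of_int p \<in> {z <..< z + d}"
    using orbit_dense(1)[of "{z <..< z + d}" x] d by auto
  obtain n' p' where np': "x + real n' * \<alpha> - of_int p' \<in> {z - d <..< z}"
    using orbit_dense(1)[of "{z - d <..< z}" x] d by auto
  define y where "y = x + real n * \<alpha> - of_int p"
  define y' where "y' = x + real n' * \<alpha> - of_int p'"
  have y: "z < y" "y < z + d" "\<bar>y - z\<bar> < e" and y': "z - d < y'" "y' < z" "\<bar>y' - z\<bar> < e"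
    using np np' d by (auto simp: y_def y'_def)
  have "frac (y - z) = y - z"
    using y d pos small by (auto simp: frac_eq)
  moreover have "frac (y' - z) = y' - z + 1"
    using y' d pos small by (auto simp: frac_unique_iff)
  ultimately have "hits k y = hits k y' + 1"
    using y y' d by (simp add: hits_near frac_near)
  moreover have "hits k y mod 3 = 0"
    by (rule return[OF y_def _ ]) (use near[OF y(3)] in blast)+
  moreover have "hits k y' mod 3 = 0"
    by (rule return[OF y'_def _ ]) (use near[OF y'(3)] in blast)+
  ultimately show False by presburger
qed

section \<open>Passage from regular points to all points of the interval\<close>

lemma flip_map_funpow_in: "y \<in> {0..3} \<Longrightarrow> (flip_map \<alpha> \<beta> ^^ n) y \<in> {0..3}"
  by (induction n) (use flip_map_in[OF pos small] in auto)

lemma flip_map_funpow_base_point: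
  assumes "y \<in> {0..3}"
  shows "base_point ((flip_map \<alpha> \<beta> ^^ n) y) - base_point y - real n * \<alpha> \<in> \<int>"
proof (induction n)
  case (Suc n)
  from Ints_add[OF this flip_map_base_point[OF flip_map_funpow_in[OF assms] pos small, of n]]
  show ?case by (simp add: algebra_simps)
qed simp

text \<open>The rotation orbit meets each of the classes of 0 and \<open>\<beta>\<close> modulo 1 at
  most once, so after finitely many steps it avoids both for good.\<close>

lemma eventually_regular:
  assumes "y \<in> {0..3}"
  shows "\<exists>N x i. regular x \<and> (flip_map \<alpha> \<beta> ^^ N) y = fibre_pos x i"
proof -
  have "\<forall>\<^sub>F n in sequentially. base_point y + real n * \<alpha> \<notin> \<int> \<and> base_point y - \<beta> + real n * \<alpha> \<notin> \<int>"
    using orbit_eventually_not_Ints by (intro eventually_conj)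
  then obtain N where N: "\<And>n. n \<ge> N \<Longrightarrow>
      base_point y + real n * \<alpha> \<notin> \<int> \<and> base_point y - \<beta> + real n * \<alpha> \<notin> \<int>"
    unfolding eventually_sequentially by blast
  define z where "z = (flip_map \<alpha> \<beta> ^^ N) y"
  have z: "z \<in> {0..3}" unfolding z_def using assms by (rule flip_map_funpow_in)
  obtain m where m: "base_point z = base_point y + real N * \<alpha> + of_int m"
    using flip_map_funpow_base_point[OF assms, of N] unfolding z_def
    by (metis Ints_cases diff_diff_eq diff_add_cancel add.commute)
  have "regular (base_point z)"
    unfolding regular_def
  proof (intro allI)
    fix j
    have "base_point z + real j * \<alpha> = base_point y + real (N + j) * \<alpha> + of_int m"
      "base_point z + real j * \<alpha> - \<beta> = base_point y - \<beta> + real (N + j) * \<alpha> + of_int m"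
      by (simp_all add: m algebra_simps)
    then show "base_point z + real j * \<alpha> \<notin> \<int> \<and> base_point z + real j * \<alpha> - \<beta> \<notin> \<int>"
      using N[of "N + j"] Ints_add_of_int by (metis le_add1)
  qed
  moreover from this have "base_point z \<notin> \<int>"
    unfolding regular_def by (metis mult_zero_left add.right_neutral of_nat_0)
  then have ni: "z \<noteq> 0" "z \<noteq> 1" "z \<noteq> 2" "z \<noteq> 3"
    by (auto simp: base_point_def)
  have "z = fibre_pos (base_point z) \<lfloor>z\<rfloor>"
  proof -
    consider "0 < z" "z < 1" | "1 < z" "z < 2" | "2 < z" "z < 3"
      using z ni by fastforce
    then show ?thesis
    proof cases
      case 1
      then have "\<lfloor>z\<rfloor> = 0" "frac z = z" by (auto simp: frac_eq floor_eq_iff)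
      with 1 show ?thesis by (simp add: fibre_pos_def base_point_def)
    next
      case 2
      then have "\<lfloor>z\<rfloor> = 1" "frac z = z - 1" by (auto simp: frac_unique_iff floor_eq_iff)
      with 2 show ?thesis by (simp add: fibre_pos_def base_point_def)
    next
      case 3
      then have "\<lfloor>z\<rfloor> = 2" "frac (- z) = 3 - z" by (auto simp: frac_unique_iff floor_eq_iff)
      with 3 show ?thesis by (simp add: fibre_pos_def base_point_def)
    qed
  qed
  ultimately show ?thesis unfolding z_def by blast
qed

lemma minimal_flip_map: "minimal_on {0..3} (flip_map \<alpha> \<beta>)"
  unfolding minimal_on_def
proof (intro ballI subsetI)
  fix y z :: real assume y: "y \<in> {0..3}" and z: "z \<in> {0..3}"
  obtain N x i where x: "regular x" and N: "(flip_map \<alpha> \<beta> ^^ N) y = fibre_pos x i"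
    using eventually_regular[OF y] by blast
  show "z \<in> closure (range (\<lambda>m. (flip_map \<alpha> \<beta> ^^ m) y))"
    unfolding closure_approachable
  proof (intro allI impI)
    fix e :: real assume e: "e > 0"
    \<comment> \<open>The target \<open>z\<close> is given by a copy \<open>i'\<close> and a
      coordinate \<open>w\<close> in it. The value \<open>w = 1\<close> occurs for
      \<open>z = 2\<close>, which counts as an end of the third copy and is approached from
      inside.\<close>
    obtain w i' where w: "0 \<le> w" "w \<le> 1"
      and close: "\<And>u. 0 < u \<Longrightarrow> u < 1 \<Longrightarrow> \<bar>u - w\<bar> < e \<Longrightarrow> \<bar>fibre_pos u i' - z\<bar> < e"
    proof (cases "z < 2")
      case True
      show thesis
      proof (rule that[of "frac z" "\<lfloor>z\<rfloor>"])
        fix u assume u: "0 < u" "u < 1" "\<bar>u - frac z\<bar> < e"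
        have "frac u = u"
          using u by (simp add: frac_eq)
        moreover have "\<lfloor>z\<rfloor> = 0 \<or> \<lfloor>z\<rfloor> = 1"
          using z True by (auto simp: floor_eq_iff)
        ultimately show "\<bar>fibre_pos u \<lfloor>z\<rfloor> - z\<bar> < e"
          using u(3) by (auto simp: fibre_pos_def frac_def)
      qed (use frac_lt_1[of z] in \<open>auto simp: less_imp_le\<close>)
    next
      case False
      show thesis
        by (rule that[of "3 - z" 2]) (use z False in \<open>auto simp: fibre_pos_def frac_eq\<close>)
    qed
    define U where "U = {max 0 (w - e) <..< min 1 (w + e)}"
    have "open U" "U \<noteq> {}"
      using e w by (auto simp: U_def)
    \<comment> \<open>The displacement \<open>i' - i\<close> moves the orbit from copy
      \<open>i\<close> into the copy that contains \<open>z\<close>.\<close>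
    then have "(i' - i) mod 3 \<in> visits x U"
      using visits_full[OF x] by auto
    then obtain n p where n: "hits n x mod 3 = (i' - i) mod 3" "x + real n * \<alpha> - of_int p \<in> U"
      unfolding visits_def by force
    define u where "u = x + real n * \<alpha> - of_int p"
    have u: "0 < u" "u < 1" "\<bar>u - w\<bar> < e"
      using n(2) by (auto simp: U_def u_def)
    have "(flip_map \<alpha> \<beta> ^^ (n + N)) y = fibre_pos (x + real n * \<alpha>) (i + hits n x)"
      using flip_map_orbit[OF x] by (simp add: funpow_add N)
    also have "frac (x + real n * \<alpha>) = frac u"
      using frac_add_of_int_right[of u p] by (simp add: u_def)
    then have "fibre_pos (x + real n * \<alpha>) (i + hits n x) = fibre_pos u (i + hits n x)"
      by (simp add: fibre_pos_def)
    also have "(i + hits n x) mod 3 = i' mod 3"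
      using n(1) by presburger
    then have "fibre_pos u (i + hits n x) = fibre_pos u i'"
      by (simp add: fibre_pos_def)
    finally have "dist ((flip_map \<alpha> \<beta> ^^ (n + N)) y) z < e"
      using close u by (simp add: dist_real_def)
    then show "\<exists>y'\<in>range (\<lambda>m. (flip_map \<alpha> \<beta> ^^ m) y). dist y' z < e"
      by blast
  qed
qed

end

section \<open>Ergodicity of irrational rotations\<close>

text \<open>Lebesgue measure of the circle, kept as a measure on the line: subsets of the circle
  appear as 1-periodic Borel sets.\<close>

definition unit_uniform :: "real measure" where
  "unit_uniform = uniform_measure lborel {0..<1}"

lemma sets_unit_uniform [simp, measurable_cong]: "sets unit_uniform = sets borel"
  by (simp add: unit_uniform_def)

lemma space_unit_uniform [simp]: "space unit_uniform = UNIV"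
  by (simp add: unit_uniform_def)

lemma prob_space_unit_uniform: "prob_space unit_uniform"
  unfolding unit_uniform_def by (rule prob_space_uniform_measure) auto

lemma emeasure_unit_uniform:
  "A \<in> sets borel \<Longrightarrow> emeasure unit_uniform A = emeasure lborel ({0..<1} \<inter> A)"
  unfolding unit_uniform_def by (simp add: divide_ennreal_def)

lemma emeasure_lborel_shift:
  fixes A :: "real set"
  assumes "A \<in> sets borel"
  shows "emeasure lborel {x. x + t \<in> A} = emeasure lborel A"
proof -
  have "emeasure lborel A = emeasure (distr lborel borel ((+) t)) A"
    by (simp add: lborel_distr_plus)
  also have "\<dots> = emeasure lborel {x. x + t \<in> A}"
    using assms by (simp add: emeasure_distr vimage_def add.commute)
  finally show ?thesis ..
qed

lemma periodic_add_of_int: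
  fixes P :: "real \<Rightarrow> 'a"
  assumes "\<And>x. P (x + 1) = P x"
  shows "P (x + of_int n) = P x"
proof (induction n rule: int_induct[where k = 0])
  case (step1 i)
  then show ?case using assms[of "x + of_int i"] by (simp add: algebra_simps)
next
  case (step2 i)
  then show ?case using assms[of "x + of_int (i - 1)"] by (simp add: algebra_simps)
qed simp

lemma emeasure_periodic_interval_shift:
  fixes A :: "real set"
  assumes "A \<in> sets borel" "\<And>x. x + 1 \<in> A \<longleftrightarrow> x \<in> A"
  shows "emeasure lborel ({a + of_int n..<b + of_int n} \<inter> A) = emeasure lborel ({a..<b} \<inter> A)"
proof -
  have "emeasure lborel ({a + of_int n..<b + of_int n} \<inter> A) =
      emeasure lborel {x. x + of_int n \<in> {a + of_int n..<b + of_int n} \<inter> A}"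
    using assms by (intro emeasure_lborel_shift[symmetric]) auto
  also have "{x. x + of_int n \<in> {a + of_int n..<b + of_int n} \<inter> A} = {a..<b} \<inter> A"
    using periodic_add_of_int[of "\<lambda>x. x \<in> A"] assms(2) by auto
  finally show ?thesis .
qed

text \<open>The translated window of length 1 is cut at an integer, and periodicity moves the two
  pieces back to fill \<open>{0..<1}\<close>.\<close>

lemma emeasure_unit_uniform_shift:
  assumes [measurable]: "A \<in> sets borel" and per: "\<And>x. x + 1 \<in> A \<longleftrightarrow> x \<in> A"
  shows "emeasure unit_uniform {x. x + t \<in> A} = emeasure unit_uniform A"
proof -
  define s where "s = t - of_int \<lfloor>t\<rfloor>"
  have s: "0 \<le> s" "s < 1" by (auto simp: s_def) linarith
  have t: "t = s + of_int \<lfloor>t\<rfloor>" by (simp add: s_def)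
  have [measurable]: "{x. x + t \<in> A} \<in> sets borel" by measurable
  have "emeasure unit_uniform {x. x + t \<in> A} = emeasure lborel {x. x + t \<in> {t..<t + 1} \<inter> A}"
    by (subst emeasure_unit_uniform) (auto intro!: arg_cong2[of _ _ _ _ emeasure])
  also have "\<dots> = emeasure lborel ({t..<t + 1} \<inter> A)"
    by (rule emeasure_lborel_shift) simp
  also have "\<dots> = emeasure lborel ({s + of_int \<lfloor>t\<rfloor>..<s + 1 + of_int \<lfloor>t\<rfloor>} \<inter> A)"
    by (subst t, subst t) (simp add: algebra_simps)
  also have "\<dots> = emeasure lborel ({s..<s + 1} \<inter> A)"
    by (rule emeasure_periodic_interval_shift[OF assms])
  also have "{s..<s + 1} \<inter> A = {s..<1} \<inter> A \<union> {0 + of_int 1..<s + of_int 1} \<inter> A"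
    using s by auto
  also have "emeasure lborel \<dots> = emeasure lborel ({s..<1} \<inter> A) +
      emeasure lborel ({0 + of_int 1..<s + of_int 1} \<inter> A)"
    by (rule plus_emeasure[symmetric]) auto
  also have "emeasure lborel ({0 + of_int 1..<s + of_int 1} \<inter> A) = emeasure lborel ({0..<s} \<inter> A)"
    by (rule emeasure_periodic_interval_shift[OF assms])
  also have "emeasure lborel ({s..<1} \<inter> A) + emeasure lborel ({0..<s} \<inter> A) =
      emeasure lborel ({s..<1} \<inter> A \<union> {0..<s} \<inter> A)"
    by (rule plus_emeasure) auto
  also have "{s..<1} \<inter> A \<union> {0..<s} \<inter> A = {0..<1} \<inter> A"
    using s by auto
  also have "emeasure lborel \<dots> = emeasure unit_uniform A"
    by (simp add: emeasure_unit_uniform)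
  finally show ?thesis .
qed

lemma AE_lborel_periodic:
  assumes Q: "{x. Q x} \<in> sets borel" and per: "\<And>x::real. Q (x + 1) = Q x"
    and ae: "AE x in unit_uniform. Q x"
  shows "AE x in lborel. Q x"
proof -
  define N where "N = {x. \<not> Q x}"
  have N [measurable]: "N \<in> sets borel" unfolding N_def using borel_comp[OF Q] by (simp add: Compl_eq)
  have perN: "x + 1 \<in> N \<longleftrightarrow> x \<in> N" for x by (simp add: N_def per)
  have "emeasure unit_uniform N = 0"
    using ae by (subst (asm) AE_iff_measurable[OF _ refl]) (use N in \<open>auto simp: N_def\<close>)
  then have N0: "emeasure lborel ({0..<1} \<inter> N) = 0"
    by (simp add: emeasure_unit_uniform)
  have "{of_int n..<1 + of_int n} \<inter> N \<in> null_sets lborel" for n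
    using emeasure_periodic_interval_shift[OF N perN, of 0 n 1] N0 by auto
  then have "(\<Union>n::int. {of_int n..<1 + of_int n} \<inter> N) \<in> null_sets lborel"
    by (intro null_sets_UN) auto
  moreover have "{x. \<not> Q x} \<subseteq> (\<Union>n::int. {of_int n..<1 + of_int n} \<inter> N)"
  proof
    fix x assume "x \<in> {x. \<not> Q x}"
    then have "x \<in> {of_int \<lfloor>x\<rfloor>..<1 + of_int \<lfloor>x\<rfloor>} \<inter> N"
      by (auto simp: N_def) linarith
    then show "x \<in> (\<Union>n::int. {of_int n..<1 + of_int n} \<inter> N)" by blast
  qed
  ultimately show ?thesis by (intro AE_I') auto
qed

text \<open>
  The measure of \<open>B \<inter> {a..<b}\<close> is invariant under translation by \<open>\<alpha>\<close> and by \<open>1\<close>, hence by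
  continuity under all translations, hence proportional to \<open>b - a\<close>.
\<close>

proposition irrational_rotation_ergodic:
  fixes B :: "real set"
  assumes \<alpha>: "\<alpha> \<notin> \<rat>" and B [measurable]: "B \<in> sets borel"
    and per: "\<And>x. x + 1 \<in> B \<longleftrightarrow> x \<in> B" and inv: "AE x in lborel. x + \<alpha> \<in> B \<longleftrightarrow> x \<in> B"
  shows "measure unit_uniform B = 0 \<or> measure unit_uniform B = 1"
proof -
  define N where "N a b = measure lborel (B \<inter> {a..<b})" for a b
  have fin: "emeasure lborel (B \<inter> {a..<b}) < \<infinity>" for a b
  proof -
    have "emeasure lborel (B \<inter> {a..<b}) \<le> emeasure lborel {a..<b}"
      by (intro emeasure_mono) auto
    also have "\<dots> < \<infinity>" by (cases "a \<le> b") auto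
    finally show ?thesis .
  qed
  have N_emeasure: "emeasure lborel (B \<inter> {a..<b}) = ennreal (N a b)" for a b
    unfolding N_def using fin[of a b] by (intro emeasure_eq_ennreal_measure) auto
  have N_nonneg: "0 \<le> N a b" for a b by (simp add: N_def)
  have N_shift: "N (a + \<tau>) (b + \<tau>) = N a b" if "AE x in lborel. x + \<tau> \<in> B \<longleftrightarrow> x \<in> B" for \<tau> a b
  proof -
    have "emeasure lborel (B \<inter> {a + \<tau>..<b + \<tau>}) = emeasure lborel {x. x + \<tau> \<in> B \<inter> {a + \<tau>..<b + \<tau>}}"
      by (rule emeasure_lborel_shift[symmetric]) auto
    also have "\<dots> = emeasure lborel (B \<inter> {a..<b})"
      by (rule emeasure_eq_AE) (use that in auto)
    finally show ?thesis by (simp add: N_def measure_def)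
  qed
  have N_nat: "N (a + real n * \<alpha>) (b + real n * \<alpha>) = N a b" for a b n
  proof (induction n)
    case (Suc n)
    then show ?case
      using N_shift[OF inv, of "a + real n * \<alpha>" "b + real n * \<alpha>"] by (simp add: algebra_simps)
  qed simp
  have N_int: "N (a + of_int p) (b + of_int p) = N a b" for a b p
    by (rule N_shift) (use periodic_add_of_int[of "\<lambda>x. x \<in> B"] per in auto)
  \<comment> \<open>The first interval is covered by the second and the gaps between old and new
    endpoints. This continuity carries invariance from the dense numbers
    \<open>k * \<alpha> - h\<close> to every translation.\<close>
  have N_Lipschitz: "N a b \<le> N a' b' + (\<bar>a - a'\<bar> + \<bar>b - b'\<bar>)" for a b a' b'
  proof -
    have "N a b \<le> measure lborel (B \<inter> {a'..<b'} \<union> ({min a a'..<max a a'} \<union> {min b b'..<max b b'}))"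
      unfolding N_def
    proof (rule measure_mono_fmeasurable)
      show "B \<inter> {a'..<b'} \<union> ({min a a'..<max a a'} \<union> {min b b'..<max b b'}) \<in> fmeasurable lborel"
        using fin by (intro fmeasurable.Un) (auto intro!: fmeasurableI)
    qed auto
    also have "\<dots> \<le> N a' b' + measure lborel ({min a a'..<max a a'} \<union> {min b b'..<max b b'})"
      unfolding N_def by (rule measure_Un_le) auto
    also have "measure lborel ({min a a'..<max a a'} \<union> {min b b'..<max b b'})
        \<le> measure lborel {min a a'..<max a a'} + measure lborel {min b b'..<max b b'}"
      by (rule measure_Un_le) auto
    also have "\<dots> = \<bar>a - a'\<bar> + \<bar>b - b'\<bar>" by auto
    finally show ?thesis by simp
  qed
  have N_translate: "N (a + t) (b + t) = N a b" for a b t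
  proof -
    have "\<bar>N (a + t) (b + t) - N a b\<bar> \<le> 0 + e" if e: "e > 0" for e
    proof -
      obtain h k where k: "k > 0" "\<bar>of_int k * \<alpha> - of_int h - t\<bar> < e / 2"
        using sequence_of_fractional_parts_is_dense[OF \<alpha> half_gt_zero[OF e]] by blast
      define s where "s = of_int k * \<alpha> - of_int h"
      have "N (a + s) (b + s) = N (a + real (nat k) * \<alpha> + of_int (- h)) (b + real (nat k) * \<alpha> + of_int (- h))"
        using k(1) by (simp add: s_def algebra_simps)
      then have "N (a + s) (b + s) = N a b"
        using N_int N_nat by metis
      moreover have "\<bar>s - t\<bar> < e / 2" using k(2) by (simp add: s_def)
      ultimately show ?thesis
        using N_Lipschitz[of "a + t" "b + t" "a + s" "b + s"] N_Lipschitz[of "a + s" "b + s" "a + t" "b + t"]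
        by (simp add: abs_minus_commute)
    qed
    then have "\<bar>N (a + t) (b + t) - N a b\<bar> \<le> 0"
      by (rule field_le_epsilon)
    then show ?thesis by simp
  qed
  have N_concat: "N a c = N a b + N b c" if "a \<le> b" "b \<le> c" for a b c
  proof -
    have "B \<inter> {a..<c} = B \<inter> {a..<b} \<union> B \<inter> {b..<c}" using that by auto
    then show ?thesis
      unfolding N_def using fin by (simp, subst measure_Union) (auto simp: less_top)
  qed
  define m where "m = N 0 1"
  have N_mult: "N 0 (real n * t) = real n * N 0 t" if "t \<ge> 0" for n t
  proof (induction n)
    case (Suc n)
    have "N 0 (real (Suc n) * t) = N 0 (real n * t) + N (0 + real n * t) (t + real n * t)"
      using N_concat[of 0 "real n * t" "real n * t + t"] that by (simp add: algebra_simps)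
    then show ?case
      using Suc N_translate[of 0 "real n * t" t] by (simp add: distrib_right)
  qed (simp add: N_def)
  have N_le: "N 0 t \<le> t" if "t \<ge> 0" for t
    using N_Lipschitz[of 0 t 0 0] that by (simp add: N_def)
  have m: "0 \<le> m" "m \<le> 1" using N_nonneg N_le[of 1] by (auto simp: m_def)
  \<comment> \<open>Whole unit steps contribute exactly \<open>m\<close>, so only the last partial
    step causes an error. The error at \<open>n * t\<close> is \<open>n\<close> times that at
    \<open>t\<close>; being bounded, it vanishes.\<close>
  have bounded: "\<bar>N 0 y - m * y\<bar> \<le> 1" if "y \<ge> 0" for y
  proof -
    define n where "n = nat \<lfloor>y\<rfloor>"
    have n: "real n \<le> y" "y < real n + 1"
      using that by (auto simp: n_def) 
    have "N 0 y = N 0 (real n) + N (0 + real n) ((y - real n) + real n)"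
      using N_concat[of 0 "real n" y] n by simp
    also have "\<dots> = real n * m + N 0 (y - real n)"
      using N_mult[of 1 n] N_translate[of 0 "real n" "y - real n"] by (simp add: m_def)
    finally have "N 0 y - m * y = N 0 (y - real n) - m * (y - real n)"
      by (simp add: algebra_simps)
    moreover have "0 \<le> m * (y - real n)" "m * (y - real n) \<le> 1"
      using m n by (auto intro: mult_le_one)
    moreover have "0 \<le> N 0 (y - real n)" "N 0 (y - real n) \<le> 1"
      using N_nonneg N_le[of "y - real n"] n by auto
    ultimately show ?thesis by linarith
  qed
  have N_linear: "N 0 t = m * t" if "t \<ge> 0" for t
  proof (rule ccontr)
    assume "N 0 t \<noteq> m * t"
    then have "\<bar>N 0 t - m * t\<bar> > 0" by simp
    then obtain n where n: "1 < real n * \<bar>N 0 t - m * t\<bar>"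
      using ex_less_of_nat_mult by blast
    have "N 0 (real n * t) - m * (real n * t) = real n * (N 0 t - m * t)"
      using N_mult[OF that] by (simp add: right_diff_distrib)
    then have "real n * \<bar>N 0 t - m * t\<bar> = \<bar>N 0 (real n * t) - m * (real n * t)\<bar>"
      by (simp add: abs_mult)
    then show False using n bounded[of "real n * t"] that by simp
  qed
  have N_eq: "N a b = m * (b - a)" if "a \<le> b" for a b
    using N_translate[of 0 a "b - a"] N_linear[of "b - a"] that by simp
  have unit: "measure unit_uniform B = m"
    by (simp add: m_def N_def measure_def emeasure_unit_uniform Int_commute)
  show ?thesis
  proof (cases "m = 0")
    case False
    with m have "m > 0" by simp
    \<comment> \<open>Proportionality makes \<open>M\<close> agree with Lebesgue measure on
      intervals, hence everywhere. As \<open>M\<close> gives no mass to the complement of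
      \<open>B\<close>, that complement is null.\<close>
    define M where "M = density lborel (\<lambda>x. ennreal (1 / m) * indicator B x)"
    have M: "emeasure M A = ennreal (1 / m) * emeasure lborel (B \<inter> A)" if [measurable]: "A \<in> sets borel" for A
    proof -
      have "emeasure M A = (\<integral>\<^sup>+ x. ennreal (1 / m) * indicator (B \<inter> A) x \<partial>lborel)"
        unfolding M_def by (subst emeasure_density) (auto simp: indicator_inter_arith mult.assoc)
      then show ?thesis by (simp add: nn_integral_cmult_indicator)
    qed
    have "lborel = M"
    proof (rule lborel_eqI)
      fix l u :: real assume "\<And>b. b \<in> Basis \<Longrightarrow> l \<bullet> b \<le> u \<bullet> b"
      then have lu: "l \<le> u" by simp
      have "AE x in lborel. x \<noteq> l" by (rule AE_lborel_singleton)
      then have "AE x in lborel. x \<in> B \<inter> box l u \<longleftrightarrow> x \<in> B \<inter> {l..<u}"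
        by (rule AE_mp) (auto simp: box_real)
      then have "emeasure lborel (B \<inter> box l u) = emeasure lborel (B \<inter> {l..<u})"
        by (intro emeasure_eq_AE) auto
      also have "\<dots> = ennreal (m * (u - l))"
        using N_emeasure N_eq[OF lu] by simp
      finally have "emeasure M (box l u) = ennreal (1 / m) * ennreal (m * (u - l))"
        by (simp add: M)
      also have "\<dots> = ennreal (u - l)"
        using \<open>m > 0\<close> lu by (subst ennreal_mult[symmetric]) auto
      finally show "emeasure M (box l u) = (\<Prod>b\<in>Basis. (u - l) \<bullet> b)"
        by simp
    qed (simp add: M_def)
    then have "emeasure lborel (- B) = emeasure M (- B)" by simp
    also have "\<dots> = 0" by (simp add: M)
    finally have null: "emeasure lborel (- B) = 0" .
    have "AE x in lborel. x \<in> B"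
      by (rule AE_I[OF _ null]) auto
    then have "emeasure lborel (B \<inter> {0..<1}) = emeasure lborel {0..<1::real}"
      by (intro emeasure_eq_AE) auto
    then have "m = 1" by (simp add: m_def N_def measure_def)
    then show ?thesis using unit by simp
  qed (use unit in simp)
qed

section \<open>Invariant measures carried by graphs\<close>

lemma AE_unit_uniformI: "(AE x in lborel. P x) \<Longrightarrow> (AE x in unit_uniform. P x)"
  unfolding unit_uniform_def by (rule AE_uniform_measureI) auto

lemma AE_not_Ints_shift: "AE x in unit_uniform. x + t \<notin> \<int>"
proof (rule AE_unit_uniformI)
  have "countable ((\<lambda>n. of_int n - t) ` (UNIV :: int set))"
    by simp
  then have "(\<lambda>n. of_int n - t) ` (UNIV :: int set) \<in> null_sets lborel"
    by (rule countable_imp_null_set_lborel)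
  moreover have "{x. x + t \<in> \<int>} \<subseteq> (\<lambda>n. of_int n - t) ` (UNIV :: int set)"
    by (auto elim!: Ints_cases simp: image_iff) (metis add_diff_cancel_right')
  ultimately show "AE x in lborel. x + t \<notin> \<int>"
    by (intro AE_I') auto
qed

lemma fibre_pos_in: "fibre_pos x i \<in> {0..3}"
  using frac_lt_1[of x] frac_ge_0[of x] by (auto simp: fibre_pos_def simp del: frac_ge_0)

lemma fibre_pos_cong: "i mod 3 = j mod 3 \<Longrightarrow> fibre_pos x i = fibre_pos x j"
  by (simp add: fibre_pos_def)

lemma floor_fibre_pos: "x \<notin> \<int> \<Longrightarrow> \<lfloor>fibre_pos x i\<rfloor> = i mod 3"
proof -
  assume "x \<notin> \<int>"
  then have "0 < frac x" "frac x < 1" by (auto simp: frac_lt_1)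
  moreover have "i mod 3 = 0 \<or> i mod 3 = 1 \<or> i mod 3 = 2" by presburger
  ultimately show ?thesis
    by (auto simp: fibre_pos_def floor_eq_iff simp del: frac_gt_0_iff)
qed

lemma base_point_fibre_pos: "\<exists>n. base_point (fibre_pos x i) = x + of_int n"
proof -
  have "base_point (fibre_pos x i) \<in> {x + of_int (- \<lfloor>x\<rfloor>), x + of_int (1 - \<lfloor>x\<rfloor>), x + of_int (- \<lfloor>x\<rfloor> - 3)}"
    using frac_lt_1[of x] frac_ge_0[of x] unfolding frac_def
    by (auto simp: fibre_pos_def base_point_def frac_def)
  then show ?thesis by blast
qed

lemma flip_map_measurable: "flip_map \<alpha> \<beta> \<in> measurable (restrict_space borel {0..3}) borel"
proof (rule measurable_restrict_space1)
  show "flip_map \<alpha> \<beta> \<in> borel_measurable borel"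
    unfolding flip_map_def[abs_def] by measurable
qed

locale coboundary_pair = rotation_pair +
  fixes f :: "real \<Rightarrow> int"
  assumes f_measurable [measurable]: "f \<in> measurable borel (count_space UNIV)"
    and f_periodic: "f (x + 1) = f x"
    and f_coboundary:
      "AE x in unit_uniform. (f (x + \<alpha>) - f x) mod 3 = of_bool (frac x < \<beta>) mod 3"
begin

definition graph_map :: "int \<Rightarrow> real \<Rightarrow> real" where
  "graph_map c x = fibre_pos x (f x + c)"

definition graph_measure :: "int \<Rightarrow> real measure" where
  "graph_measure c = distr unit_uniform (restrict_space borel {0..3}) (graph_map c)"

lemma graph_map_measurable [measurable]: "graph_map c \<in> measurable borel (restrict_space borel {0..3})"
proof (rule measurable_restrict_space2)
  show "graph_map c \<in> borel_measurable borel"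
    unfolding graph_map_def[abs_def] fibre_pos_def frac_def by measurable
qed (auto simp: graph_map_def fibre_pos_in[unfolded atLeastAtMost_iff])

lemma graph_map_periodic: "graph_map c (x + 1) = graph_map c x"
  by (simp add: graph_map_def fibre_pos_def f_periodic frac_1_eq)

lemma sets_graph_measure [simp]: "sets (graph_measure c) = sets (restrict_space borel {0..3})"
  by (simp add: graph_measure_def)

lemma space_graph_measure [simp]: "space (graph_measure c) = {0..3}"
  by (simp add: graph_measure_def space_restrict_space)

lemma emeasure_graph_measure:
  "A \<in> sets (restrict_space borel {0..3}) \<Longrightarrow>
     emeasure (graph_measure c) A = emeasure unit_uniform {x. graph_map c x \<in> A}"
  by (simp add: graph_measure_def emeasure_distr vimage_def)

lemma graph_map_vimage [measurable]:
  "A \<in> sets (restrict_space borel {0..3}) \<Longrightarrow> {x. graph_map c x \<in> A} \<in> sets borel"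
  using measurable_sets[OF graph_map_measurable, of A c] by (simp add: vimage_def)

text \<open>By the coboundary equation the fibre advance along the graph is the increment of
  \<open>f\<close> modulo 3. The graph map thus intertwines rotation and exchange almost everywhere,
  and the graph measures inherit invariance and ergodicity.\<close>

lemma flip_map_graph_map: "AE x in unit_uniform. flip_map \<alpha> \<beta> (graph_map c x) = graph_map c (x + \<alpha>)"
  using AE_not_Ints_shift[of 0] AE_not_Ints_shift[of "- \<beta>"] AE_not_Ints_shift[of \<alpha>] f_coboundary
proof eventually_elim
  case (elim x)
  then have "flip_map \<alpha> \<beta> (graph_map c x) = fibre_pos (x + \<alpha>) (f x + c + of_bool (frac x < \<beta>))"
    unfolding graph_map_def by (intro flip_map_fibre_pos[OF pos small]) auto
  also have "\<dots> = graph_map c (x + \<alpha>)"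
    unfolding graph_map_def by (rule fibre_pos_cong) (use elim(4) in presburger)
  finally show ?case .
qed

lemma flip_map_endo: "flip_map \<alpha> \<beta> \<in> measurable (graph_measure c) (graph_measure c)"
proof -
  have "flip_map \<alpha> \<beta> \<in> measurable (restrict_space borel {0..3}) (restrict_space borel {0..3})"
    using flip_map_measurable flip_map_in[OF pos small]
    by (intro measurable_restrict_space2) (auto simp: space_restrict_space)
  then show ?thesis
    by (simp cong: measurable_cong_sets)
qed

lemma invariant_graph_measure: "invariant_prob {0..3} (flip_map \<alpha> \<beta>) (graph_measure c)"
  unfolding invariant_prob_def
proof (intro conjI)
  show "prob_space (graph_measure c)"
    unfolding graph_measure_def
    by (rule prob_space.prob_space_distr[OF prob_space_unit_uniform]) simp
  show "distr (graph_measure c) (graph_measure c) (flip_map \<alpha> \<beta>) = graph_measure c"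
  proof (rule measure_eqI)
    fix A assume "A \<in> sets (distr (graph_measure c) (graph_measure c) (flip_map \<alpha> \<beta>))"
    then have A: "A \<in> sets (restrict_space borel {0..3})" by simp
    have pre: "flip_map \<alpha> \<beta> -` A \<inter> {0..3} \<in> sets (restrict_space borel {0..3})"
      using measurable_sets[OF flip_map_endo, of A c] A by simp
    have "emeasure (distr (graph_measure c) (graph_measure c) (flip_map \<alpha> \<beta>)) A =
        emeasure unit_uniform {x. graph_map c x \<in> flip_map \<alpha> \<beta> -` A \<inter> {0..3}}"
      using A pre flip_map_endo by (simp add: emeasure_distr emeasure_graph_measure)
    also have "\<dots> = emeasure unit_uniform {x. graph_map c (x + \<alpha>) \<in> A}"
    proof (rule emeasure_eq_AE)
      show "AE x in unit_uniform. x \<in> {x. graph_map c x \<in> flip_map \<alpha> \<beta> -` A \<inter> {0..3}} \<longleftrightarrow>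
          x \<in> {x. graph_map c (x + \<alpha>) \<in> A}"
        using flip_map_graph_map[of c]
        by eventually_elim (use fibre_pos_in in \<open>auto simp: graph_map_def\<close>)
      show "{x. graph_map c x \<in> flip_map \<alpha> \<beta> -` A \<inter> {0..3}} \<in> sets unit_uniform"
        using graph_map_vimage[OF pre] by simp
      have "(\<lambda>x. x + \<alpha>) -` {x. graph_map c x \<in> A} \<inter> space borel \<in> sets borel"
        by (rule measurable_sets[OF _ graph_map_vimage[OF A]]) simp
      then show "{x. graph_map c (x + \<alpha>) \<in> A} \<in> sets unit_uniform"
        by (simp add: vimage_def)
    qed
    also have "\<dots> = emeasure unit_uniform {x. graph_map c x \<in> A}"
      using emeasure_unit_uniform_shift[OF graph_map_vimage[OF A]] by (simp add: graph_map_periodic)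
    also have "\<dots> = emeasure (graph_measure c) A"
      using A by (simp add: emeasure_graph_measure)
    finally show "emeasure (distr (graph_measure c) (graph_measure c) (flip_map \<alpha> \<beta>)) A =
        emeasure (graph_measure c) A" .
  qed simp
qed (simp_all add: flip_map_endo)

text \<open>An invariant set pulls back along the graph to a periodic set that the rotation
  preserves up to a null set, and the rotation is ergodic.\<close>

lemma ergodic_graph_measure: "ergodic_prob {0..3} (flip_map \<alpha> \<beta>) (graph_measure c)"
  unfolding ergodic_prob_def
proof (intro conjI ballI impI invariant_graph_measure)
  fix A assume "A \<in> sets (graph_measure c)"
    and inv: "flip_map \<alpha> \<beta> -` A \<inter> space (graph_measure c) = A"
  then have A: "A \<in> sets (restrict_space borel {0..3})" by simp
  define B where "B = {x. graph_map c x \<in> A}"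
  have B: "B \<in> sets borel" unfolding B_def using A by (rule graph_map_vimage)
  have per: "x + 1 \<in> B \<longleftrightarrow> x \<in> B" for x by (simp add: B_def graph_map_periodic)
  have shift: "{x. x + \<alpha> \<in> B} \<in> sets borel"
    using measurable_sets[OF _ B, of "\<lambda>x. x + \<alpha>" borel] by (simp add: vimage_def)
  have "AE x in unit_uniform. x + \<alpha> \<in> B \<longleftrightarrow> x \<in> B"
    using flip_map_graph_map[of c]
  proof eventually_elim
    case (elim x)
    have "graph_map c x \<in> {0..3}" unfolding graph_map_def by (rule fibre_pos_in)
    then have "graph_map c x \<in> A \<longleftrightarrow> flip_map \<alpha> \<beta> (graph_map c x) \<in> A"
      using inv by auto
    with elim show ?case by (simp add: B_def)
  qed
  moreover have "{x. x + \<alpha> \<in> B \<longleftrightarrow> x \<in> B} = ({x. x + \<alpha> \<in> B} \<inter> B) \<union> (- {x. x + \<alpha> \<in> B} \<inter> - B)"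
    by auto
  then have "{x. x + \<alpha> \<in> B \<longleftrightarrow> x \<in> B} \<in> sets borel"
    using B shift by (auto intro!: borel_comp)
  moreover have "(x + 1 + \<alpha> \<in> B \<longleftrightarrow> x + 1 \<in> B) = (x + \<alpha> \<in> B \<longleftrightarrow> x \<in> B)" for x
    using per[of "x + \<alpha>"] per[of x] by (simp add: algebra_simps)
  ultimately have "AE x in lborel. x + \<alpha> \<in> B \<longleftrightarrow> x \<in> B"
    by (intro AE_lborel_periodic)
  then have "measure unit_uniform B = 0 \<or> measure unit_uniform B = 1"
    by (rule irrational_rotation_ergodic[OF irrational B per])
  then show "measure (graph_measure c) A = 0 \<or> measure (graph_measure c) A = 1"
    using A by (simp add: B_def measure_def emeasure_graph_measure)
qed

text \<open>The constant can be read off a point: it is the index of the copy minus the value of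
  \<open>f\<close> at the circle coordinate, modulo 3. The set \<open>G\<close> of points with
  constant \<open>c\<close> carries one measure and is null for the other.\<close>

lemma graph_measure_distinct:
  assumes "c mod 3 \<noteq> d mod 3"
  shows "graph_measure c \<noteq> graph_measure d"
proof
  assume eq: "graph_measure c = graph_measure d"
  define G where "G = {y \<in> {0..3}. (\<lfloor>y\<rfloor> - f (base_point y)) mod 3 = c mod 3}"
  have [measurable]: "base_point \<in> borel_measurable borel"
    unfolding base_point_def[abs_def] by measurable
  have "{y. (\<lfloor>y\<rfloor> - f (base_point y)) mod 3 = c mod 3} \<in> sets borel"
    by measurable
  then have G: "G \<in> sets (restrict_space borel {0..3})"
    by (auto simp: sets_restrict_space G_def)
  have in_G: "graph_map e x \<in> G \<longleftrightarrow> e mod 3 = c mod 3" if "x \<notin> \<int>" for e x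
  proof -
    obtain n where "base_point (fibre_pos x (f x + e)) = x + of_int n"
      using base_point_fibre_pos by blast
    then have "f (base_point (graph_map e x)) = f x"
      using periodic_add_of_int[of f, OF f_periodic] by (simp add: graph_map_def)
    moreover have "\<lfloor>graph_map e x\<rfloor> = (f x + e) mod 3"
      unfolding graph_map_def using that by (rule floor_fibre_pos)
    moreover have "((f x + e) mod 3 - f x) mod 3 = e mod 3"
      by (simp add: mod_simps)
    ultimately show ?thesis
      using fibre_pos_in[of x "f x + e"] by (simp add: G_def graph_map_def)
  qed
  have "emeasure (graph_measure c) G = emeasure unit_uniform UNIV"
    unfolding emeasure_graph_measure[OF G]
  proof (rule emeasure_eq_AE)
    show "AE x in unit_uniform. x \<in> {x. graph_map c x \<in> G} \<longleftrightarrow> x \<in> UNIV"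
      using AE_not_Ints_shift[of 0] by eventually_elim (simp add: in_G)
  qed (use graph_map_vimage[OF G] in auto)
  moreover have "emeasure (graph_measure d) G = emeasure unit_uniform {}"
    unfolding emeasure_graph_measure[OF G]
  proof (rule emeasure_eq_AE)
    show "AE x in unit_uniform. x \<in> {x. graph_map d x \<in> G} \<longleftrightarrow> x \<in> {}"
      using AE_not_Ints_shift[of 0] by eventually_elim (use assms in \<open>simp add: in_G\<close>)
  qed (use graph_map_vimage[OF G] in auto)
  ultimately show False
    using eq prob_space.emeasure_space_1[OF prob_space_unit_uniform] by simp
qed

end

section \<open>Maps that agree on the interval\<close>

lemma minimal_on_cong:
  assumes "\<And>x. x \<in> X \<Longrightarrow> T x = T' x" "\<And>x. x \<in> X \<Longrightarrow> T x \<in> X"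
  shows "minimal_on X T \<longleftrightarrow> minimal_on X T'"
proof -
  have "(T ^^ m) x = (T' ^^ m) x \<and> (T ^^ m) x \<in> X" if "x \<in> X" for m x
    using that by (induction m) (use assms in \<open>force+\<close>)
  then show ?thesis by (simp add: minimal_on_def)
qed

lemma invariant_prob_cong:
  assumes "\<And>x. x \<in> X \<Longrightarrow> T x = T' x"
  shows "invariant_prob X T M \<longleftrightarrow> invariant_prob X T' M"
proof -
  have "T \<in> measurable M M \<longleftrightarrow> T' \<in> measurable M M" "distr M M T = distr M M T'"
    if "sets M = sets (restrict_space borel X)"
  proof -
    have "space M = X"
      using sets_eq_imp_space_eq[OF that] by (simp add: space_restrict_space)
    then show "T \<in> measurable M M \<longleftrightarrow> T' \<in> measurable M M" "distr M M T = distr M M T'"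
      using assms by (auto intro!: measurable_cong distr_cong)
  qed
  then show ?thesis by (auto simp: invariant_prob_def)
qed

lemma ergodic_prob_cong:
  assumes "\<And>x. x \<in> X \<Longrightarrow> T x = T' x"
  shows "ergodic_prob X T M \<longleftrightarrow> ergodic_prob X T' M"
proof (cases "sets M = sets (restrict_space borel X)")
  case True
  then have "space M = X"
    using sets_eq_imp_space_eq[OF True] by (simp add: space_restrict_space)
  then have "T -` A \<inter> space M = T' -` A \<inter> space M" for A
    using assms by auto
  then show ?thesis
    unfolding ergodic_prob_def using invariant_prob_cong[OF assms] by simp
next
  case False
  then show ?thesis by (simp add: ergodic_prob_def invariant_prob_def)
qed

section \<open>Measurable coboundaries from fast rational approximation\<close>

text \<open>By \<open>approx\<close>, \<open>q k\<close> rotation steps amount to a translation by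
  \<open>\<delta> k\<close> modulo 1; \<open>summable_q\<delta>\<close> will make the supports of
  the transfer functions summable.\<close>

locale fast_approximation =
  fixes \<alpha> :: real and q :: "nat \<Rightarrow> nat" and \<delta> :: "nat \<Rightarrow> real"
  assumes \<delta>_pos: "0 < \<delta> k" and q_pos: "0 < q k"
    and approx: "real (q k) * \<alpha> - \<delta> k \<in> \<int>"
    and summable_q\<delta>: "summable (\<lambda>k. real (q k) * \<delta> k)"
    and sum_\<delta>: "3 * suminf \<delta> < 1"
begin

definition \<beta> :: real where "\<beta> = 3 * suminf \<delta>"

text \<open>Left ends of the consecutive arcs of length \<open>3 * \<delta> k\<close> that tile
  \<open>{0..<\<beta>}\<close>.\<close>

definition cut :: "nat \<Rightarrow> real" where "cut k = 3 * (\<Sum>j<k. \<delta> j)"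

lemma summable_\<delta>: "summable \<delta>"
proof (rule summable_comparison_test'[OF summable_q\<delta>])
  fix k
  have "1 * \<delta> k \<le> real (q k) * \<delta> k"
    using q_pos[of k] \<delta>_pos[of k] by (intro mult_right_mono) auto
  then show "norm (\<delta> k) \<le> real (q k) * \<delta> k"
    using \<delta>_pos[of k] by simp
qed

lemma cut_Suc: "cut (Suc k) = cut k + 3 * \<delta> k"
  by (simp add: cut_def)

lemma cut_nonneg: "0 \<le> cut k"
  using \<delta>_pos by (auto simp: cut_def intro!: sum_nonneg intro: less_imp_le)

lemma cut_le: "cut k \<le> \<beta>"
  unfolding cut_def \<beta>_def using summable_\<delta> \<delta>_pos
  by (intro mult_left_mono sum_le_suminf) (auto intro: less_imp_le)

lemma cut_tendsto: "cut \<longlonglongrightarrow> \<beta>"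
  unfolding cut_def[abs_def] \<beta>_def
  by (intro tendsto_mult tendsto_const summable_LIMSEQ summable_\<delta>)

text \<open>The bound \<open>a' + s \<le> 1\<close> keeps the shifted arc from wrapping past an
  integer.\<close>

lemma frac_shift_in:
  assumes "0 \<le> a" "0 \<le> s" "a' + s \<le> 1"
  shows "frac (x - s) \<in> {a..<a'} \<longleftrightarrow> frac x \<in> {a + s..<a' + s}"
proof -
  have u: "0 \<le> frac x" "frac x < 1" by (auto simp: frac_lt_1)
  have x: "x - frac x \<in> \<int>" by (simp add: frac_def)
  show ?thesis
  proof (cases "s < 1")
    case True
    have "frac (x - s) = (if s \<le> frac x then frac x - s else frac x - s + 1)"
      unfolding frac_unique_iff
    proof (intro conjI)
      show "x - s - (if s \<le> frac x then frac x - s else frac x - s + 1) \<in> \<int>"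
        using x Ints_diff[OF x Ints_1] by (auto simp: algebra_simps)
      show "0 \<le> (if s \<le> frac x then frac x - s else frac x - s + 1)"
        "(if s \<le> frac x then frac x - s else frac x - s + 1) < 1"
        using u True assms(2) by (simp_all del: frac_ge_0)
    qed
    then show ?thesis using u assms by (auto simp del: frac_ge_0 split: if_splits)
  next
    case False
    then show ?thesis using u assms frac_ge_0[of "x - s"] by (auto simp del: frac_ge_0)
  qed
qed

section \<open>The coboundary attached to a single arc\<close>

definition block :: "nat \<Rightarrow> real \<Rightarrow> int" where
  "block k x = of_bool (frac x \<in> {cut k..<cut k + \<delta> k})"

definition block_diff :: "nat \<Rightarrow> real \<Rightarrow> int" where
  "block_diff k x = block k x - block k (x - \<delta> k)"

text \<open>Summing backwards along \<open>q k\<close> steps makes the increment under one rotation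
  telescope to a difference over \<open>q k\<close> steps, that is, over \<open>\<delta> k\<close>.
  Starting at \<open>Suc 0\<close> makes the increment from \<open>x\<close> to
  \<open>x + \<alpha>\<close> begin with \<open>block_diff k x\<close>.\<close>

definition transfer_term :: "nat \<Rightarrow> real \<Rightarrow> int" where
  "transfer_term k x = (\<Sum>j<q k. block_diff k (x - real (Suc j) * \<alpha>))"

lemma cut_room: "cut k + 3 * \<delta> k < 1"
  using cut_le[of "Suc k"] sum_\<delta> by (simp add: cut_Suc \<beta>_def)

lemma block_shift:
  "block k (x - \<delta> k) = of_bool (frac x \<in> {cut k + \<delta> k..<cut k + 2 * \<delta> k})"
  "block k (x - 2 * \<delta> k) = of_bool (frac x \<in> {cut k + 2 * \<delta> k..<cut k + 3 * \<delta> k})"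
  unfolding block_def
  using frac_shift_in[of "cut k" "\<delta> k" "cut k + \<delta> k" x] frac_shift_in[of "cut k" "2 * \<delta> k" "cut k + \<delta> k" x]
    cut_nonneg[of k] \<delta>_pos[of k] cut_room[of k]
  by (simp_all add: algebra_simps)

lemma block_add_of_int: "block k (x + of_int n) = block k x"
  by (simp add: block_def)

lemma block_diff_add_of_int: "block_diff k (x + of_int n) = block_diff k x"
  using block_add_of_int[of k x n] block_add_of_int[of k "x - \<delta> k" n] by (simp add: block_diff_def algebra_simps)

lemma transfer_term_periodic: "transfer_term k (x + 1) = transfer_term k x"
proof -
  have "block_diff k (x + 1 - t) = block_diff k (x - t)" for t
    using block_diff_add_of_int[of k "x - t" 1] by (simp add: algebra_simps)
  then show ?thesis by (simp add: transfer_term_def)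
qed

lemma transfer_term_coboundary: "transfer_term k (x + \<alpha>) - transfer_term k x = block_diff k x - block_diff k (x - \<delta> k)"
proof -
  have "transfer_term k (x + \<alpha>) - transfer_term k x = (\<Sum>j<q k. block_diff k (x - real j * \<alpha>) - block_diff k (x - real (Suc j) * \<alpha>))"
    unfolding transfer_term_def by (simp add: sum_subtractf algebra_simps)
  also have "\<dots> = block_diff k (x - real 0 * \<alpha>) - block_diff k (x - real (q k) * \<alpha>)"
    by (rule sum_lessThan_telescope')
  finally have "transfer_term k (x + \<alpha>) - transfer_term k x = block_diff k x - block_diff k (x - real (q k) * \<alpha>)"
    by simp
  moreover obtain p where "real (q k) * \<alpha> - \<delta> k = of_int p"
    using approx by (auto elim: Ints_cases)
  then have "x - real (q k) * \<alpha> = x - \<delta> k + of_int (- p)"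
    by (simp add: algebra_simps)
  ultimately show ?thesis by (metis block_diff_add_of_int)
qed

text \<open>For indicators \<open>a\<close>, \<open>b\<close>, \<open>c\<close> of the thirds of the
  arc, \<open>a + b + c = 3 * b + (a - 2 * b + c)\<close>, and the second difference in brackets is
  the telescoped increment.\<close>

lemma indicator_mod_coboundary:
  "of_bool (frac x \<in> {cut k..<cut (Suc k)}) = 3 * block k (x - \<delta> k) + (transfer_term k (x + \<alpha>) - transfer_term k x)"
proof -
  have "transfer_term k (x + \<alpha>) - transfer_term k x = block k x - 2 * block k (x - \<delta> k) + block k (x - 2 * \<delta> k)"
    unfolding transfer_term_coboundary by (simp add: block_diff_def algebra_simps)
  then show ?thesis
    using \<delta>_pos[of k] unfolding block_shift by (auto simp: block_def cut_Suc)
qed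

lemma partial_sums_coboundary:
  "((\<Sum>k<K. transfer_term k (x + \<alpha>)) - (\<Sum>k<K. transfer_term k x)) mod 3 = of_bool (frac x < cut K) mod 3"
proof (induction K)
  case (Suc K)
  have "(of_bool (frac x < cut (Suc K)) :: int) =
      of_bool (frac x < cut K) + of_bool (frac x \<in> {cut K..<cut (Suc K)})"
    using \<delta>_pos[of K] by (auto simp: cut_Suc)
  also have "\<dots> = of_bool (frac x < cut K) + (transfer_term K (x + \<alpha>) - transfer_term K x) + 3 * block K (x - \<delta> K)"
    unfolding indicator_mod_coboundary by (simp only: ac_simps)
  finally have "of_bool (frac x < cut (Suc K)) mod 3 =
      (of_bool (frac x < cut K) + (transfer_term K (x + \<alpha>) - transfer_term K x)) mod 3"
    by simp
  also have "\<dots> = ((\<Sum>k<K. transfer_term k (x + \<alpha>)) - (\<Sum>k<K. transfer_term k x) + (transfer_term K (x + \<alpha>) - transfer_term K x)) mod 3"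
    using Suc by (metis mod_add_left_eq)
  finally show ?case by (simp add: algebra_simps)
qed (simp add: cut_def not_less)

lemma eventually_outside: "\<forall>\<^sub>F k in sequentially. frac x \<notin> {cut k..<cut (Suc k)}"
proof (cases "frac x < \<beta>")
  case True
  then show ?thesis
    using order_tendstoD(1)[OF cut_tendsto True] by (auto elim!: eventually_mono)
next
  case False
  then show ?thesis using cut_le by (auto intro!: always_eventually simp: not_less intro: order_trans)
qed

text \<open>Once \<open>x\<close> lies outside arc \<open>k\<close>, the indicator and the middle
  block vanish there, so the terms at \<open>x\<close> and \<open>x + \<alpha>\<close>
  coincide.\<close>

lemma eventually_transfer_term_shift:
  assumes "\<forall>\<^sub>F k in sequentially. transfer_term k x = 0"
  shows "\<forall>\<^sub>F k in sequentially. transfer_term k (x + \<alpha>) = 0"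
  using assms eventually_outside[of x]
proof eventually_elim
  case (elim k)
  then show ?case
    using indicator_mod_coboundary[of x k] \<delta>_pos[of k] by (auto simp: block_shift cut_Suc split: if_splits)
qed

lemma eventually_less_cut: "\<forall>\<^sub>F K in sequentially. (frac x < cut K) = (frac x < \<beta>)"
proof (cases "frac x < \<beta>")
  case True
  then show ?thesis
    using order_tendstoD(1)[OF cut_tendsto] by (auto elim!: eventually_mono)
next
  case False
  then show ?thesis using cut_le by (auto intro!: always_eventually simp: not_less intro: order_trans)
qed

lemma block_measurable [measurable]: "block k \<in> measurable borel (count_space UNIV)"
  unfolding block_def[abs_def] frac_def atLeastLessThan_iff by measurable

lemma block_diff_measurable [measurable]: "block_diff k \<in> measurable borel (count_space UNIV)"
  unfolding block_diff_def[abs_def] by measurable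

lemma transfer_term_measurable [measurable]: "transfer_term k \<in> measurable borel (count_space UNIV)"
proof -
  have "(\<lambda>x. \<Sum>j<m. block_diff k (x - real (Suc j) * \<alpha>)) \<in> measurable borel (count_space UNIV)" for m
    by (induction m) simp_all
  then show ?thesis unfolding transfer_term_def[abs_def] .
qed

section \<open>Almost everywhere finiteness and the limit transfer function\<close>

lemma block_diff_support: "emeasure unit_uniform {x. block_diff k x \<noteq> 0} \<le> ennreal (2 * \<delta> k)"
proof -
  have "emeasure unit_uniform {x. block_diff k x \<noteq> 0} = emeasure lborel ({0..<1} \<inter> {x. block_diff k x \<noteq> 0})"
    by (rule emeasure_unit_uniform) measurable
  also have "\<dots> \<le> emeasure lborel {cut k..<cut k + 2 * \<delta> k}"
    by (rule emeasure_mono) (auto simp: block_diff_def block_shift, auto simp: block_def split: if_splits)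
  also have "\<dots> = ennreal (2 * \<delta> k)"
    using \<delta>_pos[of k] by simp
  finally show ?thesis .
qed

text \<open>A union bound over \<open>q k\<close> translates of the support of
  \<open>block_diff k\<close>; the bounds are summable, as Borel-Cantelli requires.\<close>

lemma transfer_term_support: "emeasure unit_uniform {x. transfer_term k x \<noteq> 0} \<le> ennreal (2 * (real (q k) * \<delta> k))"
proof -
  have "emeasure unit_uniform {x. block_diff k (x + t) \<noteq> 0} \<le> ennreal (2 * \<delta> k)" for t
  proof -
    have "emeasure unit_uniform {x. x + t \<in> {x. block_diff k x \<noteq> 0}} = emeasure unit_uniform {x. block_diff k x \<noteq> 0}"
      by (rule emeasure_unit_uniform_shift) (use block_diff_add_of_int[of k _ 1] in auto)
    then show ?thesis using block_diff_support[of k] by simp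
  qed
  from this[of "- t" for t]
  have *: "emeasure unit_uniform {x. block_diff k (x - t) \<noteq> 0} \<le> ennreal (2 * \<delta> k)" for t
    by simp
  have "emeasure unit_uniform {x. transfer_term k x \<noteq> 0} \<le>
      emeasure unit_uniform (\<Union>j<q k. {x. block_diff k (x - real (Suc j) * \<alpha>) \<noteq> 0})"
  proof (rule emeasure_mono)
    show "{x. transfer_term k x \<noteq> 0} \<subseteq> (\<Union>j<q k. {x. block_diff k (x - real (Suc j) * \<alpha>) \<noteq> 0})"
      unfolding transfer_term_def by (auto dest: sum.not_neutral_contains_not_neutral)
    have "{x. block_diff k (x - real (Suc j) * \<alpha>) \<noteq> 0} \<in> sets borel" for j
      by measurable
    then show "(\<Union>j<q k. {x. block_diff k (x - real (Suc j) * \<alpha>) \<noteq> 0}) \<in> sets unit_uniform"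
      by (intro sets.finite_UN) auto
  qed
  also have "\<dots> \<le> (\<Sum>j<q k. emeasure unit_uniform {x. block_diff k (x - real (Suc j) * \<alpha>) \<noteq> 0})"
  proof (rule emeasure_subadditive_finite)
    have "{x. block_diff k (x - real (Suc j) * \<alpha>) \<noteq> 0} \<in> sets borel" for j
      by measurable
    then show "(\<lambda>j. {x. block_diff k (x - real (Suc j) * \<alpha>) \<noteq> 0}) ` {..<q k} \<subseteq> sets unit_uniform"
      by auto
  qed simp
  also have "\<dots> \<le> (\<Sum>j<q k. ennreal (2 * \<delta> k))"
    by (intro sum_mono *)
  also have "\<dots> = ennreal (2 * (real (q k) * \<delta> k))"
    using \<delta>_pos[of k] by (simp add: ennreal_of_nat_eq_real_of_nat ennreal_mult[symmetric] mult.assoc mult.left_commute)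
  finally show ?thesis .
qed

lemma AE_eventually_transfer_term: "AE x in unit_uniform. \<forall>\<^sub>F k in sequentially. transfer_term k x = 0"
proof -
  interpret prob_space unit_uniform by (rule prob_space_unit_uniform)
  have meas: "{x. transfer_term k x \<noteq> 0} \<in> sets unit_uniform" for k by measurable
  have le: "measure unit_uniform {x. transfer_term k x \<noteq> 0} \<le> 2 * (real (q k) * \<delta> k)" for k
    using transfer_term_support[of k] \<delta>_pos[of k] unfolding emeasure_eq_measure
    by (subst (asm) ennreal_le_iff) auto
  have "summable (\<lambda>k. measure unit_uniform {x. transfer_term k x \<noteq> 0})"
    by (rule summable_comparison_test'[OF summable_mult[OF summable_q\<delta>, of 2]]) (use le in auto)
  then have "AE x in unit_uniform. \<forall>\<^sub>F k in sequentially. x \<in> space unit_uniform - {x. transfer_term k x \<noteq> 0}"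
    using meas by (intro borel_cantelli_AE1) (auto simp: emeasure_eq_measure)
  then show ?thesis by simp
qed

text \<open>The floor of a real series is an integer-valued measurable function on the whole line.
  Almost everywhere the series has finitely many nonzero terms and the floor is their sum.\<close>

definition transfer :: "real \<Rightarrow> int" where
  "transfer x = \<lfloor>\<Sum>k. real_of_int (transfer_term k x)\<rfloor>"

lemma transfer_measurable: "transfer \<in> measurable borel (count_space UNIV)"
  unfolding transfer_def[abs_def] by measurable

lemma transfer_periodic: "transfer (x + 1) = transfer x"
  by (simp add: transfer_def transfer_term_periodic)

lemma eventually_transfer:
  assumes "\<forall>\<^sub>F k in sequentially. transfer_term k x = 0"
  shows "\<forall>\<^sub>F K in sequentially. (\<Sum>k<K. transfer_term k x) = transfer x"
proof -
  obtain N where N: "\<And>k. k \<ge> N \<Longrightarrow> transfer_term k x = 0"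
    using assms unfolding eventually_sequentially by blast
  have "(\<Sum>k<K. transfer_term k x) = transfer x" if "K \<ge> N" for K
  proof -
    have "(\<Sum>k. real_of_int (transfer_term k x)) = (\<Sum>k<K. real_of_int (transfer_term k x))"
      using N that by (intro suminf_finite) auto
    also have "\<dots> = of_int (\<Sum>k<K. transfer_term k x)" by simp
    finally show ?thesis by (simp only: transfer_def floor_of_int)
  qed
  then show ?thesis unfolding eventually_sequentially by blast
qed

lemma transfer_coboundary:
  "AE x in unit_uniform. (transfer (x + \<alpha>) - transfer x) mod 3 = of_bool (frac x < \<beta>) mod 3"
  using AE_eventually_transfer_term
proof eventually_elim
  case (elim x)
  \<comment> \<open>The claim does not mention \<open>K\<close>; it suffices to find one
    \<open>K\<close> at which both partial sums and the arc have stabilised.\<close>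
  have "\<forall>\<^sub>F K in sequentially. (transfer (x + \<alpha>) - transfer x) mod 3 = of_bool (frac x < \<beta>) mod 3"
    using eventually_transfer[OF elim] eventually_transfer[OF eventually_transfer_term_shift[OF elim]] eventually_less_cut[of x]
  proof eventually_elim
    case (elim K)
    then show ?case using partial_sums_coboundary[where K = K and x = x] by simp
  qed
  then show ?case by simp
qed

end

section \<open>A rapidly approximable number\<close>

text \<open>Each denominator is the fourth power of the one before, so even the square of
  \<open>denom k\<close> times the reciprocals beyond it is summable in \<open>k\<close>. The
  rotation number will be \<open>recip_tail 0\<close>.\<close>

definition denom :: "nat \<Rightarrow> nat" where "denom k = 2 ^ (4 ^ Suc k)"

definition recip_tail :: "nat \<Rightarrow> real" where "recip_tail k = (\<Sum>j. 1 / real (denom (j + k)))"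

definition gap :: "nat \<Rightarrow> real" where "gap k = real (denom k) * recip_tail (Suc k)"

lemma denom_Suc: "denom (Suc k) = denom k ^ 4"
  by (simp add: denom_def power_mult[symmetric] mult.commute)

lemma denom_ge: "16 \<le> denom k"
proof (induction k)
  case (Suc k)
  have "denom k ^ 1 \<le> denom k ^ 4" using Suc by (intro power_increasing) auto
  with Suc show ?case by (simp add: denom_Suc)
qed (simp add: denom_def)

lemma denom_growth: "denom k * 16 ^ j \<le> denom (k + j)"
proof (induction j)
  case (Suc j)
  have "denom (k + j) * 16 \<le> denom (k + j) * denom (k + j) ^ 3"
    using denom_ge[of "k + j"] self_le_power[of "denom (k + j)" 3] by (intro mult_left_mono) linarith+
  also have "\<dots> = denom (k + Suc j)" by (simp add: denom_Suc power_numeral_reduce)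
  finally show ?case using Suc by simp
qed simp

lemma denom_dvd: "j \<le> k \<Longrightarrow> denom j dvd denom k"
  unfolding denom_def by (intro le_imp_power_dvd power_increasing) auto

lemma denom_pos: "0 < real (denom k)"
  using denom_ge[of k] by simp

lemma denom_gt_index: "k < denom k"
proof -
  have "k < 1 * 16 ^ k" by (induction k) auto
  also have "1 * 16 ^ k \<le> denom 0 * 16 ^ k" using denom_ge[of 0] by (intro mult_right_mono) auto
  also have "\<dots> \<le> denom k" using denom_growth[of 0 k] by simp
  finally show ?thesis .
qed

lemma recip_bound: "1 / real (denom (j + k)) \<le> 1 / real (denom k) * (1 / 16) ^ j"
proof -
  have "real (denom k) * 16 ^ j \<le> real (denom (j + k))"
    using denom_growth[of k j] by (metis add.commute of_nat_le_iff of_nat_mult of_nat_numeral of_nat_power)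
  then have "1 / real (denom (j + k)) \<le> 1 / (real (denom k) * 16 ^ j)"
    by (intro divide_left_mono mult_pos_pos denom_pos) auto
  then show ?thesis by (simp add: power_one_over)
qed

lemma summable_recip: "summable (\<lambda>j. 1 / real (denom (j + k)))"
  by (rule summable_comparison_test'[OF summable_mult[OF summable_geometric[of "1 / 16"]], of 0 _ "1 / real (denom k)"])
    (use recip_bound in auto)

lemma recip_tail_pos: "0 < recip_tail k"
  unfolding recip_tail_def using denom_pos by (intro suminf_pos summable_recip) auto

lemma recip_tail_le: "recip_tail k \<le> 16 / 15 / real (denom k)"
proof -
  have "recip_tail k \<le> (\<Sum>j. 1 / real (denom k) * (1 / 16) ^ j)"
    unfolding recip_tail_def
    by (intro suminf_le recip_bound summable_recip summable_mult summable_geometric) auto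
  also have "\<dots> = 1 / real (denom k) * (\<Sum>j. (1 / 16) ^ j)"
    by (intro suminf_mult summable_geometric) auto
  also have "\<dots> = 16 / 15 / real (denom k)"
    by (subst suminf_geometric) auto
  finally show ?thesis .
qed

lemma recip_tail_split: "recip_tail 0 = recip_tail k + (\<Sum>j<k. 1 / real (denom j))"
  using suminf_split_initial_segment[OF summable_recip[of 0], of k] by (simp add: recip_tail_def)

lemma gap_pos: "0 < gap k"
  unfolding gap_def by (intro mult_pos_pos denom_pos recip_tail_pos)

lemma gap_le: "gap k \<le> 2 / real (denom k) ^ 3"
proof -
  have "gap k \<le> real (denom k) * (16 / 15 / real (denom (Suc k)))"
    unfolding gap_def using recip_tail_le denom_pos by (intro mult_left_mono) (auto intro: less_imp_le)
  also have "\<dots> = 16 / 15 / real (denom k) ^ 3"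
    using denom_pos[of k] by (simp add: denom_Suc power_numeral_reduce field_simps)
  also have "\<dots> \<le> 2 / real (denom k) ^ 3"
    using denom_pos[of k] by (intro divide_right_mono) auto
  finally show ?thesis .
qed

text \<open>By divisibility, \<open>denom k\<close> clears the reciprocals up to index
  \<open>k\<close>; what remains of the series is \<open>gap k\<close>.\<close>

lemma denom_times_recip_tail: "real (denom k) * recip_tail 0 - gap k \<in> \<int>"
proof -
  have "real (denom k) * recip_tail 0 - gap k = (\<Sum>j<Suc k. real (denom k) / real (denom j))"
    unfolding gap_def using recip_tail_split[of "Suc k"]
    by (simp add: algebra_simps sum_distrib_left)
  moreover have "real (denom k) / real (denom j) \<in> \<int>" if "j < Suc k" for j
    using denom_dvd[of j k] that by (auto simp: dvd_def)
  ultimately show ?thesis by (auto simp del: sum.lessThan_Suc)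
qed

lemma denom_gap_le: "real (denom k) * gap k \<le> 1 / real (denom k)"
proof -
  have "real (denom k) * gap k \<le> real (denom k) * (2 / real (denom k) ^ 3)"
    using gap_le denom_pos by (intro mult_left_mono) (auto intro: less_imp_le)
  also have "\<dots> = 1 / real (denom k) * (2 / real (denom k))"
    using denom_pos[of k] by (simp add: power_numeral_reduce field_simps)
  also have "\<dots> \<le> 1 / real (denom k) * 1"
    using denom_ge[of k] by (intro mult_left_mono) (auto simp: field_simps)
  finally show ?thesis by simp
qed

lemma summable_denom_gap: "summable (\<lambda>k. real (denom k) * gap k)"
  by (rule summable_comparison_test'[OF summable_recip[of 0], of 0])
    (use denom_gap_le gap_pos in \<open>auto simp: abs_mult abs_of_pos\<close>)

text \<open>The constant is \<open>2 / 16 ^ 2\<close>, from \<open>denom_ge\<close>. In this form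
  the gaps beyond an index sum to a small multiple of \<open>recip_tail\<close>, hence of the
  preceding gap over its denominator.\<close>

lemma gap_le_recip: "gap k \<le> 1 / 128 * (1 / real (denom k))"
proof -
  have "256 \<le> real (denom k) * real (denom k)"
    using denom_ge[of k] mult_mono[of 16 "real (denom k)" 16 "real (denom k)"] by simp
  then have "2 / (real (denom k) * real (denom k)) \<le> 1 / 128"
    by (subst divide_le_eq) auto
  then have "1 / real (denom k) * (2 / (real (denom k) * real (denom k))) \<le> 1 / real (denom k) * (1 / 128)"
    by (intro mult_left_mono) auto
  then show ?thesis
    using gap_le[of k] by (simp add: power_numeral_reduce field_simps)
qed

lemma summable_gap: "summable gap"
  by (rule summable_comparison_test'[OF summable_mult[OF summable_recip[of 0]], of 0 _ "1 / 128"])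
    (use gap_le_recip gap_pos in \<open>auto simp: abs_of_pos\<close>)

lemma gap_tail_le: "(\<Sum>j. gap (j + k)) \<le> 1 / 128 * recip_tail k"
proof -
  have "(\<Sum>j. gap (j + k)) \<le> (\<Sum>j. 1 / 128 * (1 / real (denom (j + k))))"
    using summable_gap
    by (intro suminf_le gap_le_recip summable_mult summable_recip) simp
  also have "\<dots> = 1 / 128 * recip_tail k"
    unfolding recip_tail_def by (intro suminf_mult summable_recip)
  finally show ?thesis .
qed

lemma recip_tail_0_le: "recip_tail 0 \<le> 1 / 15"
  using recip_tail_le[of 0] by (simp add: denom_def)

lemma suminf_gap_le: "suminf gap \<le> 1 / 1000"
  using gap_tail_le[of 0] recip_tail_0_le by simp

section \<open>Irrationality and independence\<close>

lemma positive_small_not_Ints: "0 < x \<Longrightarrow> x < 1 \<Longrightarrow> x \<notin> \<int>" for x :: real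
  by (auto elim!: Ints_cases)

text \<open>A denominator \<open>n\<close> would make \<open>n * gap n\<close> an integer, but it
  lies strictly between 0 and 1 because \<open>n < denom n\<close>.\<close>

lemma recip_tail_irrational: "recip_tail 0 \<notin> \<rat>"
proof
  assume "recip_tail 0 \<in> \<rat>"
  then obtain n :: nat and m where n: "n \<noteq> 0" "\<bar>recip_tail 0\<bar> = real m / real n"
    by (rule Rats_abs_nat_div_natE)
  then have m: "real n * recip_tail 0 = real m"
    using recip_tail_pos[of 0] by (simp add: field_simps)
  have "real n * (real (denom n) * recip_tail 0 - gap n) \<in> \<int>"
    by (intro Ints_mult denom_times_recip_tail) simp
  then have "real (denom n) * real m - real n * gap n \<in> \<int>"
    unfolding m[symmetric] by (simp add: algebra_simps)
  from Ints_diff[OF _ this, of "real (denom n) * real m"] have "real n * gap n \<in> \<int>"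
    by simp
  moreover have "real n * gap n < 1"
  proof -
    have "real n * gap n < real (denom n) * gap n"
      using denom_gt_index[of n] gap_pos[of n] by (intro mult_strict_right_mono) auto
    also have "\<dots> \<le> 1 / real (denom n)" by (rule denom_gap_le)
    also have "\<dots> \<le> 1" using denom_ge[of n] by simp
    finally show ?thesis .
  qed
  ultimately show False
    using positive_small_not_Ints[of "real n * gap n"] n gap_pos[of n] by simp
qed

lemma sum_denom_le: "(\<Sum>k<Suc K. real (denom k)) \<le> 2 * real (denom K)"
proof (induction K)
  case (Suc K)
  have "2 * real (denom K) \<le> real (denom (Suc K))"
    using denom_growth[of K 1] by (simp add: denom_pos) 
  with Suc show ?case by simp
qed (simp add: denom_def)

text \<open>
  Multiplying a relation \<open>3 * suminf gap = m * \<alpha> + r\<close> by \<open>denom K\<close> and discarding integer terms leaves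
  an integer which, for large \<open>K\<close>, lies strictly between 0 and 1.
\<close>

lemma gap_sum_independent:
  fixes m r :: int
  shows "3 * suminf gap \<noteq> of_int m * recip_tail 0 + of_int r"
proof
  assume eq: "3 * suminf gap = of_int m * recip_tail 0 + of_int r"
  \<comment> \<open>An index is smaller than its denominator, so this choice gives
    \<open>denom K\<close> above the absolute value of \<open>m\<close>.\<close>
  define K where "K = nat \<bar>m\<bar>"
  define \<alpha> where "\<alpha> = recip_tail 0"
  define S where "S = (\<Sum>k<Suc K. real (denom k))"
  define R where "R = (\<Sum>j. gap (j + Suc K))"
  define I where "I k = real (denom k) * \<alpha> - gap k" for k
  have I: "I k \<in> \<int>" for k unfolding I_def \<alpha>_def by (rule denom_times_recip_tail)
  have K_large: "real (denom K) > \<bar>of_int m\<bar>" "real (denom K) \<ge> 16"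
    using denom_gt_index[of K] denom_ge[of K] by (auto simp: K_def)
  have "suminf gap = R + (\<Sum>k<Suc K. gap k)"
    unfolding R_def by (rule suminf_split_initial_segment[OF summable_gap])
  also have "(\<Sum>k<Suc K. gap k) = S * \<alpha> - (\<Sum>k<Suc K. I k)"
    by (simp add: I_def S_def sum_subtractf sum_distrib_right del: sum.lessThan_Suc)
  finally have "real (denom K) * (3 * (R + (S * \<alpha> - (\<Sum>k<Suc K. I k)))) =
      real (denom K) * (of_int m * \<alpha> + of_int r)"
    using eq by (simp add: \<alpha>_def)
  then have "3 * (real (denom K) * R) + (3 * S - of_int m) * (real (denom K) * \<alpha>) =
      real (denom K) * (of_int r + 3 * (\<Sum>k<Suc K. I k))"
    by (simp add: algebra_simps del: sum.lessThan_Suc)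
  \<comment> \<open>Here \<open>denom K * \<alpha>\<close> is replaced by
    \<open>gap K + I K\<close>, and the integer part \<open>I K\<close> goes to the right.\<close>
  then have "3 * (real (denom K) * R) + (3 * S - of_int m) * gap K =
      real (denom K) * (of_int r + 3 * (\<Sum>k<Suc K. I k)) - (3 * S - of_int m) * I K"
    by (simp add: I_def algebra_simps del: sum.lessThan_Suc)
  moreover have "S \<in> \<int>" unfolding S_def by (intro Ints_sum) simp
  then have "real (denom K) * (of_int r + 3 * (\<Sum>k<Suc K. I k)) - (3 * S - of_int m) * I K \<in> \<int>"
    using I by (intro Ints_diff Ints_mult Ints_add Ints_sum) auto
  ultimately have int: "3 * (real (denom K) * R) + (3 * S - of_int m) * gap K \<in> \<int>"
    by simp
  have S: "real (denom K) \<le> S" "S \<le> 2 * real (denom K)"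
    using sum_denom_le[of K] by (auto simp: S_def sum_nonneg)
  have R: "0 < R" "R \<le> 1 / 128 * recip_tail (Suc K)"
    unfolding R_def using gap_tail_le gap_pos summable_gap
    by (auto intro!: suminf_pos simp: summable_iff_shift simp del: add_Suc_right)
  \<comment> \<open>The coefficient is positive since \<open>S\<close> is at least
    \<open>denom K\<close>, and at most \<open>7 * denom K\<close>. The two summands are therefore
    at most \<open>7 / 16\<close> and \<open>3 / (128 * 16)\<close>.\<close>
  have "0 < (3 * S - of_int m) * gap K"
    using S K_large gap_pos[of K] by (intro mult_pos_pos) auto
  moreover have "0 < real (denom K) * R" using R denom_pos by simp
  moreover have "real (denom K) * R \<le> 1 / 128 * gap K"
    using mult_left_mono[OF R(2), of "real (denom K)"] by (simp add: gap_def)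
  moreover have "(3 * S - of_int m) * gap K \<le> (7 * real (denom K)) * gap K"
    using S K_large gap_pos[of K] by (intro mult_right_mono) auto
  moreover have "1 / real (denom K) \<le> 1 / 16"
    using K_large(2) by (intro divide_left_mono) auto
  then have "real (denom K) * gap K \<le> 1 / 16" "gap K \<le> 1 / 16"
    using denom_gap_le[of K] gap_le_recip[of K] by linarith+
  ultimately have "0 < 3 * (real (denom K) * R) + (3 * S - of_int m) * gap K"
    "3 * (real (denom K) * R) + (3 * S - of_int m) * gap K < 1"
    by linarith+
  then show False using int positive_small_not_Ints by blast
qed

section \<open>The example with \<open>\<alpha> = recip_tail 0\<close> and
  \<open>\<beta> = 3 * suminf gap\<close>\<close>

theorem theorem1:
  "\<exists>(n::nat) (len :: nat \<Rightarrow> real) (\<pi>\<^sub>0 :: nat \<Rightarrow> nat) (\<pi>\<^sub>1 :: nat \<Rightarrow> nat) (F :: nat set).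
     fiet_data n len \<pi>\<^sub>0 \<pi>\<^sub>1 F \<and>
     fiet_irreducible n \<pi>\<^sub>0 \<pi>\<^sub>1 \<and>
     minimal_on (fiet_interval n len) (fiet n len \<pi>\<^sub>0 \<pi>\<^sub>1 F) \<and>
     \<not> uniquely_ergodic_on (fiet_interval n len) (fiet n len \<pi>\<^sub>0 \<pi>\<^sub>1 F) \<and>
     (\<exists>M1 M2 M3. M1 \<noteq> M2 \<and> M1 \<noteq> M3 \<and> M2 \<noteq> M3 \<and>
        ergodic_prob (fiet_interval n len) (fiet n len \<pi>\<^sub>0 \<pi>\<^sub>1 F) M1 \<and>
        ergodic_prob (fiet_interval n len) (fiet n len \<pi>\<^sub>0 \<pi>\<^sub>1 F) M2 \<and>
        ergodic_prob (fiet_interval n len) (fiet n len \<pi>\<^sub>0 \<pi>\<^sub>1 F) M3)"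
proof -
  interpret approx: fast_approximation "recip_tail 0" denom gap
  proof
    show "3 * suminf gap < 1"
      using suminf_gap_le by simp
  qed (use gap_pos denom_pos denom_times_recip_tail summable_denom_gap in simp_all)
  define \<alpha> where "\<alpha> = recip_tail 0"
  define \<beta> where "\<beta> = 3 * suminf gap"
  have \<beta>: "approx.\<beta> = \<beta>"
    by (simp add: approx.\<beta>_def \<beta>_def)
  interpret coboundary_pair \<alpha> \<beta> approx.transfer
  proof
    show "0 < \<alpha>" "\<alpha> \<notin> \<rat>"
      unfolding \<alpha>_def by (rule recip_tail_pos recip_tail_irrational)+
    show "0 < \<beta>"
      using suminf_pos[OF summable_gap gap_pos] by (simp add: \<beta>_def)
    show "\<alpha> + \<beta> < 1"
      using recip_tail_0_le suminf_gap_le by (simp add: \<alpha>_def \<beta>_def)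
    show "\<beta> \<noteq> of_int m * \<alpha> + of_int r" for m r
      unfolding \<alpha>_def \<beta>_def by (rule gap_sum_independent)
    show "AE x in unit_uniform.
        (approx.transfer (x + \<alpha>) - approx.transfer x) mod 3 = of_bool (frac x < \<beta>) mod 3"
      using approx.transfer_coboundary by (simp add: \<alpha>_def \<beta>)
  qed (rule approx.transfer_measurable approx.transfer_periodic)+
  define T where "T = fiet 9 (exchange_lengths \<alpha> \<beta>) id exchange_perm {4, 9}"
  have X: "fiet_interval 9 (exchange_lengths \<alpha> \<beta>) = {0..3}"
    by (simp add: fiet_interval_def fiet_length_exchange)
  have T: "T y = flip_map \<alpha> \<beta> y" if "y \<in> {0..3}" for y
    unfolding T_def using that by (rule fiet_exchange[OF pos small])
  have "minimal_on {0..3} T"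
    using minimal_flip_map T flip_map_in[OF pos small] by (subst minimal_on_cong[OF T]) auto
  moreover have erg: "ergodic_prob {0..3} T (graph_measure c)" for c
    using ergodic_graph_measure by (subst ergodic_prob_cong[OF T])
  moreover have distinct: "graph_measure 0 \<noteq> graph_measure 1" "graph_measure 0 \<noteq> graph_measure 2"
    "graph_measure 1 \<noteq> graph_measure 2"
    by (rule graph_measure_distinct; simp)+
  moreover have "\<not> uniquely_ergodic_on {0..3} T"
    using erg distinct(1) unfolding uniquely_ergodic_on_def ergodic_prob_def by blast
  ultimately show ?thesis
    using fiet_data_exchange[OF pos small] fiet_irreducible_exchange X unfolding T_def by metis
qed

end
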